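(* Let $\Theta=(\Gamma,(x_{k,i}))$ be a patch framework in $\mathbb{R}^d$ with $\Gamma$ connected, with every view affinely non-degenerate, and with $m=2$ views. Let $S\in\mathbb{O}(d)^2$ be a perfect alignment. Then $S$ is unique if and only if $\mathrm{rank}(\overline B_{1,2})=d$.
   Context: Patch framework. $\Gamma$ is a bipartite graph on $n+m$ vertices; vertex $k\in\{1,\dots,n\}$ represents the $k$th point and vertex $n+i$, $i\in\{1,\dots,m\}$, the $i$th view; $(k,i)\in E(\Gamma)$ means that point $k$ is in view $i$, with local coordinates $x_{k,i}\in\mathbb{R}^d$. The tuple $\Theta=(\Gamma,(x_{k,i}))$ is a patch framework. A view $i$ is affinely non-degenerate if it has at least $d+1$ points and the affine span of $\{x_{k,i}:(k,i)\in E(\Gamma)\}$ has dimension $d$. Put $e_{ki}=e_k-e_{n+i}\in\mathbb{R}^{n+m}$, $\varepsilon_i$ the $i$th standard basis vector of $\mathbb{R}^m$, $\mathcal{L}_\Gamma=\sum_{(k,i)\in E(\Gamma)}e_{ki}e_{ki}^T$, $B=\sum_{(k,i)\in E(\Gamma)}(\varepsilon_i\otimes I_d)x_{k,i}e_{ki}^T$, $D=\sum_{(k,i)\in E(\Gamma)}(\varepsilon_i\otimes I_d)x_{k,i}x_{k,i}^T(\varepsilon_i\otimes I_d)^T$, and $C=D-B\mathcal{L}_\Gamma^\dagger B^T\in\mathbb{R}^{md\times md}$ (positive semi-definite), where $\dagger$ is the Moore–Penrose pseudoinverse. An alignment is an element $S=[S_i]_1^m$ (vertical stack) of $\mathbb{O}(d)^m\subseteq\mathbb{R}^{md\times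 d}$; $F(S)=\mathrm{Tr}(CSS^T)$; $S$ is perfect if $F(S)=0$ (hence optimal, i.e. a global minimizer of $F$). An optimal alignment $S$ is unique if every other optimal alignment $O$ is of the form $O=SQ$ for some $Q\in\mathbb{O}(d)$. For two views $i,j$, $B_{i,j}$ is the matrix whose columns are the $x_{k,i}$ (in increasing order of $k$) over all $k$ with $(k,i),(k,j)\in E(\Gamma)$; $n'$ is its number of columns and $\overline B_{i,j}=B_{i,j}(I_{n'}-(1/n')\mathbf{1}_{n'}\mathbf{1}_{n'}^T)$, with $\mathbf{1}_{n'}$ the all-ones vector. *)

theory Defs
  imports
    Jordan_Normal_Form.Matrix
    Jordan_Normal_Form.DL_Rank
    Graph_Theory.Pair_Digraph
    Graph_Theory.Digraph_Component
begin

section \<open>Matrix preliminaries\<close>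

definition col_mat :: "real vec \<Rightarrow> real mat" where
  "col_mat v = mat_of_cols (dim_vec v) [v]"

definition mat_trace :: "real mat \<Rightarrow> real" where
  "mat_trace A = (\<Sum>a<dim_row A. A $$ (a, a))"

definition mat_sum :: "nat \<Rightarrow> nat \<Rightarrow> ('i \<Rightarrow> real mat) \<Rightarrow> 'i set \<Rightarrow> real mat" where
  "mat_sum nr nc f I = mat nr nc (\<lambda>ab. \<Sum>i\<in>I. f i $$ ab)"

definition kronecker :: "real mat \<Rightarrow> real mat \<Rightarrow> real mat" (infixl \<open>\<otimes>\<^sub>m\<close> 70) where
  "A \<otimes>\<^sub>m B = mat (dim_row A * dim_row B) (dim_col A * dim_col B)
     (\<lambda>(a, b). A $$ (a div dim_row B, b div dim_col B) * B $$ (a mod dim_row B, b mod dim_col B))"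

definition is_pseudoinverse :: "real mat \<Rightarrow> real mat \<Rightarrow> bool" where
  "is_pseudoinverse A X \<longleftrightarrow>
     X \<in> carrier_mat (dim_col A) (dim_row A) \<and>
     A * X * A = A \<and> X * A * X = X \<and>
     transpose_mat (A * X) = A * X \<and> transpose_mat (X * A) = X * A"

text \<open>At most one matrix satisfies the four Penrose conditions.\<close>

lemma is_pseudoinverse_unique:
  assumes X: "is_pseudoinverse A X" and Y: "is_pseudoinverse A Y"
  shows "X = Y"
proof -
  define r c where "r = dim_row A" and "c = dim_col A"
  have A: "A \<in> carrier_mat r c" by (simp add: r_def c_def)
  have cX: "X \<in> carrier_mat c r" and cY: "Y \<in> carrier_mat c r"
    using X Y by (auto simp: is_pseudoinverse_def r_def c_def)
  note ca = A cX cY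
  note X = X[unfolded is_pseudoinverse_def] and Y = Y[unfolded is_pseudoinverse_def]
  have AX: "A * X = A * Y"
  proof -
    have "A * X = transpose_mat (A * X)" using X by simp
    also have "\<dots> = transpose_mat ((A * Y) * (A * X))"
      using Y assoc_mult_mat[of "A * Y" r r A c X r] ca by simp
    also have "\<dots> = transpose_mat (A * X) * transpose_mat (A * Y)"
      using ca by (intro transpose_mult) auto
    also have "\<dots> = (A * X) * (A * Y)" using X Y by simp
    also have "\<dots> = A * Y"
      using X assoc_mult_mat[of "A * X" r r A c Y r] ca by simp
    finally show ?thesis .
  qed
  have XA: "X * A = Y * A"
  proof -
    have "X * A = transpose_mat (X * A)" using X by simp
    also have "\<dots> = transpose_mat ((X * A) * (Y * A))"
      using Y assoc_mult_mat[of X c r A c "Y * A" c] assoc_mult_mat[of A r c Y r A c] ca by simp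
    also have "\<dots> = transpose_mat (Y * A) * transpose_mat (X * A)"
      using ca by (intro transpose_mult) auto
    also have "\<dots> = (Y * A) * (X * A)" using X Y by simp
    also have "\<dots> = Y * A"
      using X assoc_mult_mat[of Y c r A c "X * A" c] assoc_mult_mat[of A r c X r A c] ca by simp
    finally show ?thesis .
  qed
  have "X = Y * A * X" using X XA by simp
  also have "\<dots> = Y * (A * Y)" using AX ca by simp
  also have "\<dots> = Y" using Y assoc_mult_mat[of Y c r A c Y r] ca by simp
  finally show ?thesis .
qed

definition pseudoinverse :: "real mat \<Rightarrow> real mat" where
  "pseudoinverse A = (THE X. is_pseudoinverse A X)"

text \<open>
  The affine span and its dimension, the latter being the dimension of the space of differences.
  For empty \<open>X\<close> the affine span is empty and the value of \<open>affine_span_dim\<close> is meaningless.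
\<close>

definition affine_span :: "nat \<Rightarrow> real vec set \<Rightarrow> real vec set" where
  "affine_span d X = {vec d (\<lambda>a. \<Sum>p\<in>P. c p * p $ a) | P c.
     finite P \<and> P \<noteq> {} \<and> P \<subseteq> X \<and> (\<Sum>p\<in>P. c p) = 1}"

definition affine_span_dim :: "nat \<Rightarrow> real vec set \<Rightarrow> nat" where
  "affine_span_dim d X = vectorspace.dim class_ring
     ((module_vec TYPE(real) d)\<lparr>carrier := {u - v | u v. u \<in> affine_span d X \<and> v \<in> affine_span d X}\<rparr>)"

definition orthogonal_group :: "nat \<Rightarrow> real mat set" where
  "orthogonal_group d = {Q \<in> carrier_mat d d. transpose_mat Q * Q = 1\<^sub>m d \<and> Q * transpose_mat Q = 1\<^sub>m d}"


section \<open>Patch frameworks\<close>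

text \<open>
  Following the library's indexing of matrices, points are numbered \<open>0, \<dots>, n - 1\<close>
  and views \<open>0, \<dots>, m - 1\<close>, where \<open>n = npoints\<close> and \<open>m = nviews\<close>. In the graph, point \<open>k\<close> is the
  vertex \<open>k\<close> and view \<open>i\<close> is the vertex \<open>n + i\<close>; the field \<open>edges\<close> holds the pairs \<open>(k, i)\<close>
  with point \<open>k\<close> in view \<open>i\<close>. The values \<open>coord k i\<close> matter only for such pairs.
\<close>

record patch_framework =
  amb_dim :: nat
  npoints :: nat
  nviews :: nat
  edges :: "(nat \<times> nat) set"
  coord :: "nat \<Rightarrow> nat \<Rightarrow> real vec"

definition wf_patch_framework :: "patch_framework \<Rightarrow> bool" where
  "wf_patch_framework \<Theta> \<longleftrightarrow>
     edges \<Theta> \<subseteq> {..<npoints \<Theta>} \<times> {..<nviews \<Theta>} \<and>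
     (\<forall>(k, i)\<in>edges \<Theta>. coord \<Theta> k i \<in> carrier_vec (amb_dim \<Theta>))"

definition patch_graph :: "patch_framework \<Rightarrow> nat pair_pre_digraph" where
  "patch_graph \<Theta> =
     \<lparr> pverts = {..<npoints \<Theta> + nviews \<Theta>},
       parcs = (\<Union>(k, i)\<in>edges \<Theta>. {(k, npoints \<Theta> + i), (npoints \<Theta> + i, k)}) \<rparr>"

definition view_points :: "patch_framework \<Rightarrow> nat \<Rightarrow> nat set" where
  "view_points \<Theta> i = {k. (k, i) \<in> edges \<Theta>}"

definition affinely_nondegenerate :: "patch_framework \<Rightarrow> nat \<Rightarrow> bool" where
  "affinely_nondegenerate \<Theta> i \<longleftrightarrow>
     card (view_points \<Theta> i) \<ge> amb_dim \<Theta> + 1 \<and>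
     affine_span_dim (amb_dim \<Theta>) ((\<lambda>k. coord \<Theta> k i) ` view_points \<Theta> i) = amb_dim \<Theta>"

definition edge_vec :: "patch_framework \<Rightarrow> nat \<Rightarrow> nat \<Rightarrow> real mat" where
  "edge_vec \<Theta> k i = col_mat (unit_vec (npoints \<Theta> + nviews \<Theta>) k
     - unit_vec (npoints \<Theta> + nviews \<Theta>) (npoints \<Theta> + i))"

text \<open>\<open>block_coord \<Theta> k i\<close> is the column \<open>(\<epsilon>\<^sub>i \<otimes> I\<^sub>d) x\<^sub>k\<^sub>,\<^sub>i\<close> of length \<open>m d\<close>.\<close>

definition block_coord :: "patch_framework \<Rightarrow> nat \<Rightarrow> nat \<Rightarrow> real mat" where
  "block_coord \<Theta> k i =
     (col_mat (unit_vec (nviews \<Theta>) i) \<otimes>\<^sub>m 1\<^sub>m (amb_dim \<Theta>)) * col_mat (coord \<Theta> k i)"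

definition laplacian :: "patch_framework \<Rightarrow> real mat" where
  "laplacian \<Theta> = mat_sum (npoints \<Theta> + nviews \<Theta>) (npoints \<Theta> + nviews \<Theta>)
     (\<lambda>(k, i). edge_vec \<Theta> k i * transpose_mat (edge_vec \<Theta> k i)) (edges \<Theta>)"

definition B_mat :: "patch_framework \<Rightarrow> real mat" where
  "B_mat \<Theta> = mat_sum (nviews \<Theta> * amb_dim \<Theta>) (npoints \<Theta> + nviews \<Theta>)
     (\<lambda>(k, i). block_coord \<Theta> k i * transpose_mat (edge_vec \<Theta> k i)) (edges \<Theta>)"

definition D_mat :: "patch_framework \<Rightarrow> real mat" where
  "D_mat \<Theta> = mat_sum (nviews \<Theta> * amb_dim \<Theta>) (nviews \<Theta> * amb_dim \<Theta>)
     (\<lambda>(k, i). block_coord \<Theta> k i * transpose_mat (block_coord \<Theta> k i)) (edges \<Theta>)"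

definition C_mat :: "patch_framework \<Rightarrow> real mat" where
  "C_mat \<Theta> = D_mat \<Theta> - B_mat \<Theta> * pseudoinverse (laplacian \<Theta>) * transpose_mat (B_mat \<Theta>)"


section \<open>Alignments\<close>

definition stack :: "nat \<Rightarrow> nat \<Rightarrow> (nat \<Rightarrow> real mat) \<Rightarrow> real mat" where
  "stack m d Ss = mat (m * d) d (\<lambda>(a, b). Ss (a div d) $$ (a mod d, b))"

definition alignments :: "patch_framework \<Rightarrow> real mat set" where
  "alignments \<Theta> = {stack (nviews \<Theta>) (amb_dim \<Theta>) Ss | Ss.
     \<forall>i<nviews \<Theta>. Ss i \<in> orthogonal_group (amb_dim \<Theta>)}"

definition alignment_error :: "patch_framework \<Rightarrow> real mat \<Rightarrow> real" where
  "alignment_error \<Theta> S = mat_trace (C_mat \<Theta> * S * transpose_mat S)"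

definition perfect_alignment :: "patch_framework \<Rightarrow> real mat \<Rightarrow> bool" where
  "perfect_alignment \<Theta> S \<longleftrightarrow> S \<in> alignments \<Theta> \<and> alignment_error \<Theta> S = 0"

definition optimal_alignment :: "patch_framework \<Rightarrow> real mat \<Rightarrow> bool" where
  "optimal_alignment \<Theta> S \<longleftrightarrow> S \<in> alignments \<Theta> \<and>
     (\<forall>O'\<in>alignments \<Theta>. alignment_error \<Theta> S \<le> alignment_error \<Theta> O')"

definition unique_alignment :: "patch_framework \<Rightarrow> real mat \<Rightarrow> bool" where
  "unique_alignment \<Theta> S \<longleftrightarrow> optimal_alignment \<Theta> S \<and>
     (\<forall>O'. optimal_alignment \<Theta> O' \<and> O' \<noteq> S \<longrightarrow> (\<exists>Q\<in>orthogonal_group (amb_dim \<Theta>). O' = S * Q))"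


section \<open>Overlap of two views\<close>

definition overlap_mat :: "patch_framework \<Rightarrow> nat \<Rightarrow> nat \<Rightarrow> real mat" where
  "overlap_mat \<Theta> i j = mat_of_cols (amb_dim \<Theta>)
     (map (\<lambda>k. coord \<Theta> k i) (sorted_list_of_set (view_points \<Theta> i \<inter> view_points \<Theta> j)))"

definition centered_overlap_mat :: "patch_framework \<Rightarrow> nat \<Rightarrow> nat \<Rightarrow> real mat" where
  "centered_overlap_mat \<Theta> i j =
     (let n' = dim_col (overlap_mat \<Theta> i j);
          ones = col_mat (vec n' (\<lambda>_. 1))
      in overlap_mat \<Theta> i j * (1\<^sub>m n' - (1 / real n') \<cdot>\<^sub>m (ones * transpose_mat ones)))"

end

theory Submission
  imports Defs
begin

text \<open>
  Each column \<open>s\<close> of an alignment contributes \<open>s \<bullet> C s\<close> to the error, and this is the residual of the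
  least squares problem of fitting the values \<open>w\<^sub>k - w\<^sub>n\<^sub>+\<^sub>i\<close> to the aligned coordinates over all edges.
  Hence \<open>F \<ge> 0\<close>, and \<open>F = 0\<close> exactly when translations make all views agree. For two views only the
  common points constrain the fit: \<open>S\<^sub>0\<^sup>T x\<^sub>k\<^sub>,\<^sub>0 - S\<^sub>1\<^sup>T x\<^sub>k\<^sub>,\<^sub>1\<close> must not depend on \<open>k\<close>.
  The centred overlap has rank \<open>d\<close> iff no hyperplane contains all \<open>x\<^sub>k\<^sub>,\<^sub>0\<close> of the overlap.
  If a hyperplane does, reflecting the first view across it gives a second perfect alignment.
  If none does, \<open>S\<^sub>1 S\<^sub>0\<^sup>T\<close> is determined by its values on the differences of common points.
\<close>

section \<open>Real linear algebra and the existence of pseudoinverses\<close>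

lemma scalar_prod_eq_0_real:
  assumes "(v :: real vec) \<in> carrier_vec n" "v \<bullet> v = 0"
  shows "v = 0\<^sub>v n"
proof (rule eq_vecI)
  fix i assume "i < dim_vec (0\<^sub>v n :: real vec)"
  then have i: "i < n" by simp
  have "(\<Sum>j\<in>{0..<n}. v $ j * v $ j) = 0"
    using assms by (simp add: scalar_prod_def)
  then have "v $ i * v $ i = 0"
    using i by (subst (asm) sum_nonneg_eq_0_iff) auto
  then show "v $ i = 0\<^sub>v n $ i" using i by simp
qed (use assms in simp)

lemma obtain_inverse_mat:
  fixes A :: "'a :: field mat"
  assumes A: "A \<in> carrier_mat n n"
    and ker: "\<And>v. v \<in> carrier_vec n \<Longrightarrow> A *\<^sub>v v = 0\<^sub>v n \<Longrightarrow> v = 0\<^sub>v n"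
  obtains B where "B \<in> carrier_mat n n" "A * B = 1\<^sub>m n" "B * A = 1\<^sub>m n"
proof -
  have "det A \<noteq> 0" using det_0_iff_vec_prod_zero[OF A] ker by blast
  from det_non_zero_imp_unit[OF A this, of "()"] that show ?thesis
    unfolding Units_def by (auto simp: ring_mat_def)
qed

lemma minus_zero_mat: "(A :: 'a :: group_add mat) \<in> carrier_mat m n \<Longrightarrow> A - 0\<^sub>m m n = A"
  by (rule eq_matI) auto

lemma mat_sum_carrier [simp]: "mat_sum nr nc f I \<in> carrier_mat nr nc"
  by (simp add: mat_sum_def)

text \<open>\<open>laplacian\<close>, \<open>B_mat\<close> and \<open>D_mat\<close> are sums of
  outer products over the edges. Exchanging the sums leaves one product of scalar products per edge.
  Describing \<open>f\<close> by its entries lets the summands be products of one-column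
  matrices.\<close>

lemma scalar_prod_mat_sum_mult:
  assumes u: "\<And>e. e \<in> I \<Longrightarrow> u e \<in> carrier_vec p" and v: "\<And>e. e \<in> I \<Longrightarrow> v e \<in> carrier_vec q"
    and f: "\<And>e a b. e \<in> I \<Longrightarrow> a < p \<Longrightarrow> b < q \<Longrightarrow> f e $$ (a, b) = u e $ a * v e $ b"
    and s: "s \<in> carrier_vec p" and t: "t \<in> carrier_vec q"
  shows "s \<bullet> (mat_sum p q f I *\<^sub>v t) = (\<Sum>e\<in>I. (u e \<bullet> s) * (v e \<bullet> t))"
proof -
  have "s \<bullet> (mat_sum p q f I *\<^sub>v t)
    = (\<Sum>a\<in>{0..<p}. \<Sum>b\<in>{0..<q}. \<Sum>e\<in>I. (u e $ a * s $ a) * (v e $ b * t $ b))"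
    using s t f
    by (simp add: mat_sum_def scalar_prod_def sum_distrib_left sum_distrib_right mult_ac)
  also have "\<dots> = (\<Sum>a\<in>{0..<p}. \<Sum>e\<in>I. \<Sum>b\<in>{0..<q}. (u e $ a * s $ a) * (v e $ b * t $ b))"
    by (intro sum.cong refl sum.swap)
  also have "\<dots> = (\<Sum>e\<in>I. \<Sum>a\<in>{0..<p}. \<Sum>b\<in>{0..<q}. (u e $ a * s $ a) * (v e $ b * t $ b))"
    by (rule sum.swap)
  also have "\<dots> = (\<Sum>e\<in>I. (u e \<bullet> s) * (v e \<bullet> t))"
    using s t u v by (intro sum.cong refl) (simp add: scalar_prod_def sum_product)
  finally show ?thesis .
qed

text \<open>The inverse of the Laplacian perturbed by the projection onto the constants is the
  pseudoinverse up to that same projection.\<close>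

lemma pseudoinverse_from_ones:
  fixes L :: "real mat"
  assumes L: "L \<in> carrier_mat N N" and sym: "L\<^sup>T = L"
    and ones: "L *\<^sub>v vec N (\<lambda>_. 1) = 0\<^sub>v N"
    and ker: "\<And>x. x \<in> carrier_vec N \<Longrightarrow> x \<bullet> (L *\<^sub>v x) = 0 \<Longrightarrow> (\<forall>i<N. \<forall>j<N. x $ i = x $ j)"
    and psd: "\<And>x. x \<in> carrier_vec N \<Longrightarrow> x \<bullet> (L *\<^sub>v x) \<ge> 0"
  shows "\<exists>X. is_pseudoinverse L X"
proof (cases "N = 0")
  case True
  then have "is_pseudoinverse L L" using L by (auto simp: is_pseudoinverse_def)
  then show ?thesis ..
next
  case False
  \<comment> \<open>The orthogonal projection onto the constant vectors. Dividing by
    \<open>N\<close>, and below the entry \<open>x $ 0\<close>, make sense for \<open>N > 0\<close>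
    only, whence the case distinction.\<close>
  define J where "J = mat N N (\<lambda>_. 1 / real N)"
  have J: "J \<in> carrier_mat N N" by (simp add: J_def)
  have JT: "J\<^sup>T = J" by (rule eq_matI) (auto simp: J_def)
  have LJ: "L * J = 0\<^sub>m N N"
  proof (rule eq_matI)
    fix i j assume ij: "i < dim_row (0\<^sub>m N N :: real mat)" "j < dim_col (0\<^sub>m N N :: real mat)"
    have "(L *\<^sub>v vec N (\<lambda>_. 1)) $ i = 0" using ones ij by simp
    then have "(\<Sum>k\<in>{0..<N}. L $$ (i, k)) = 0" using ij L by (simp add: scalar_prod_def)
    then show "(L * J) $$ (i, j) = 0\<^sub>m N N $$ (i, j)"
      using ij L by (simp add: J_def scalar_prod_def sum_divide_distrib[symmetric])
  qed (use L J in auto)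
  have JL: "J * L = 0\<^sub>m N N"
    using arg_cong[OF LJ, of transpose_mat] transpose_mult[OF L J] sym JT by simp
  have JJ: "J * J = J"
    by (rule eq_matI) (use False in \<open>auto simp: J_def scalar_prod_def\<close>)
  define M where "M = L + J"
  have M: "M \<in> carrier_mat N N" using L J by (simp add: M_def)
  \<comment> \<open>The form of \<open>M\<close> is the sum of two nonnegative terms. If both
    vanish, the first makes \<open>x\<close> constant and the second makes its entries sum to
    0.\<close>
  have "x = 0\<^sub>v N" if x: "x \<in> carrier_vec N" and Mx: "M *\<^sub>v x = 0\<^sub>v N" for x
  proof -
    have Jx: "J *\<^sub>v x = vec N (\<lambda>_. (\<Sum>k\<in>{0..<N}. x $ k) / real N)"
      using x by (intro eq_vecI) (auto simp: J_def scalar_prod_def sum_divide_distrib)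
    have xJx: "x \<bullet> (J *\<^sub>v x) = (\<Sum>k\<in>{0..<N}. x $ k)\<^sup>2 / real N"
      using x unfolding Jx
      by (simp add: scalar_prod_def sum_distrib_right[symmetric] power2_eq_square
          sum_divide_distrib[symmetric])
    have "0 = x \<bullet> (M *\<^sub>v x)" using Mx x by simp
    also have "\<dots> = x \<bullet> (L *\<^sub>v x) + x \<bullet> (J *\<^sub>v x)"
      using x L J by (simp add: M_def add_mult_distrib_mat_vec[OF L J x]
          scalar_prod_add_distrib[of x N])
    finally have *: "x \<bullet> (L *\<^sub>v x) + (\<Sum>k\<in>{0..<N}. x $ k)\<^sup>2 / real N = 0" using xJx by simp
    have nn: "(\<Sum>k\<in>{0..<N}. x $ k)\<^sup>2 / real N \<ge> 0" by simp
    have "x \<bullet> (L *\<^sub>v x) = 0" and s0: "(\<Sum>k\<in>{0..<N}. x $ k)\<^sup>2 / real N = 0"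
      using * nn psd[OF x] by linarith+
    have c: "x $ i = x $ j" if "i < N" "j < N" for i j
      using ker[OF x \<open>x \<bullet> (L *\<^sub>v x) = 0\<close>] that by blast
    have s: "(\<Sum>k\<in>{0..<N}. x $ k) = 0" using s0 False by simp
    have "(\<Sum>k\<in>{0..<N}. x $ k) = (\<Sum>k\<in>{0..<N}. x $ 0)"
      by (intro sum.cong refl c) (use False in auto)
    with s False have x0: "x $ 0 = 0" by simp
    show ?thesis
    proof (rule eq_vecI)
      fix i assume "i < dim_vec (0\<^sub>v N :: real vec)"
      moreover from this have "x $ i = x $ 0" by (intro c) auto
      ultimately show "x $ i = 0\<^sub>v N $ i" using x0 by simp
    qed (use x in simp)
  qed
  then obtain W where W: "W \<in> carrier_mat N N" and MW: "M * W = 1\<^sub>m N" and WM: "W * M = 1\<^sub>m N"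
    using obtain_inverse_mat[OF M] by blast
  have MJ: "M * J = J"
    using LJ JJ J L by (simp add: M_def add_mult_distrib_mat[OF L J J])
  have JM: "J * M = J"
    using JL JJ J L by (simp add: M_def mult_add_distrib_mat[OF J L J])
  \<comment> \<open>\<open>M\<close> acts as the identity on the constants, hence so does its
    inverse.\<close>
  have WJ: "W * J = J"
    using arg_cong[OF MJ, of "(*) W"] WM J by (simp add: assoc_mult_mat[OF W M J, symmetric])
  have JW: "J * W = J"
    using arg_cong[OF JM, of "\<lambda>A. A * W"] MW J by (simp add: assoc_mult_mat[OF J M W])
  \<comment> \<open>Subtracting \<open>J\<close> makes the constants part of the kernel again. Both
    \<open>L * X\<close> and \<open>X * L\<close> then equal \<open>1\<^sub>m N - J\<close>, the
    projection orthogonal to the constants, and all four Penrose conditions follow from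
    this.\<close>
  define X where "X = W - J"
  have X: "X \<in> carrier_mat N N" using W J by (simp add: X_def minus_carrier_mat)
  have LM: "L = M - J" using L J by (intro eq_matI) (auto simp: M_def)
  have JX: "J * X = 0\<^sub>m N N"
    using J W JW JJ by (simp add: X_def mult_minus_distrib_mat[OF J W J])
  have LX: "L * X = 1\<^sub>m N - J"
  proof -
    have "M * X = 1\<^sub>m N - J" using MW MJ by (simp add: X_def mult_minus_distrib_mat[OF M W J])
    then show ?thesis
      using LM JX minus_mult_distrib_mat[OF M J X] J by (simp add: minus_zero_mat minus_carrier_mat)
  qed
  have WL: "W * L = 1\<^sub>m N - J"
    using LM mult_minus_distrib_mat[OF W M J] WM WJ by simp
  have XL: "X * L = 1\<^sub>m N - J"
    using WL JL J by (simp add: X_def minus_mult_distrib_mat[OF W J L] minus_zero_mat minus_carrier_mat)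
  have "L * X * L = L"
    using LX J L JL by (simp add: minus_mult_distrib_mat[OF one_carrier_mat J L] minus_zero_mat)
  moreover have "X * L * X = X"
    using XL J X JX by (simp add: minus_mult_distrib_mat[OF one_carrier_mat J X] minus_zero_mat)
  moreover have "(1\<^sub>m N - J)\<^sup>T = 1\<^sub>m N - J"
    using transpose_minus[OF one_carrier_mat J] JT by simp
  ultimately have "is_pseudoinverse L X"
    using L X LX XL by (simp add: is_pseudoinverse_def)
  then show ?thesis ..
qed

text \<open>Transposing preserves each of the first two Penrose conditions and swaps the other two.
  Together with uniqueness this makes the pseudoinverse of a symmetric matrix symmetric.\<close>

lemma is_pseudoinverse_transpose:
  assumes "is_pseudoinverse A X"
  shows "is_pseudoinverse A\<^sup>T X\<^sup>T"
proof -
  define r c where "r = dim_row A" and "c = dim_col A"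
  have A: "A \<in> carrier_mat r c" by (simp add: r_def c_def)
  have X: "X \<in> carrier_mat c r" using assms by (simp add: is_pseudoinverse_def r_def c_def)
  note h = assms[unfolded is_pseudoinverse_def]
  have 1: "A\<^sup>T * X\<^sup>T = (X * A)\<^sup>T" and 2: "X\<^sup>T * A\<^sup>T = (A * X)\<^sup>T"
    using transpose_mult[OF X A] transpose_mult[OF A X] by simp_all
  have AT: "A\<^sup>T \<in> carrier_mat c r" and XT: "X\<^sup>T \<in> carrier_mat r c" using A X by auto
  have "A\<^sup>T * X\<^sup>T * A\<^sup>T = (A * (X * A))\<^sup>T"
    using 1 transpose_mult[of A r c "X * A" c] A X by simp
  then have 3: "A\<^sup>T * X\<^sup>T * A\<^sup>T = A\<^sup>T" using h assoc_mult_mat[OF A X A] by simp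
  have "X\<^sup>T * A\<^sup>T * X\<^sup>T = (X * (A * X))\<^sup>T"
    using 2 transpose_mult[of X c r "A * X" r] A X by simp
  then have 4: "X\<^sup>T * A\<^sup>T * X\<^sup>T = X\<^sup>T" using h assoc_mult_mat[OF X A X] by simp
  show ?thesis using h 1 2 3 4 AT XT A X by (simp add: is_pseudoinverse_def)
qed

lemma pseudoinverse_eq: "is_pseudoinverse A X \<Longrightarrow> pseudoinverse A = X"
  unfolding pseudoinverse_def by (blast intro: the_equality is_pseudoinverse_unique)

section \<open>Residual of a least squares problem and the trace form\<close>

text \<open>Expanding the squares gives the forms of \<open>D\<close>, \<open>B\<close> and
  \<open>L\<close>; with \<open>z = X *\<^sub>v (B\<^sup>T *\<^sub>v s)\<close> the condition
  \<open>X * L * X = X\<close> merges the last two into the subtracted term. The second claim stands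
  in for the minimality of the residual at \<open>z\<close>: an exact fit \<open>w\<close> gives
  \<open>B\<^sup>T *\<^sub>v s = L *\<^sub>v w\<close>, and \<open>L * X * L = L\<close> turns the
  subtracted term into the form of \<open>D\<close>.\<close>

lemma residual_quadratic_form:
  fixes D B L X :: "real mat"
  assumes pinv: "is_pseudoinverse L X"
    and D: "D \<in> carrier_mat p p" and B: "B \<in> carrier_mat p q" and L: "L \<in> carrier_mat q q"
    and symL: "L\<^sup>T = L"
    and hD: "\<And>s t. s \<in> carrier_vec p \<Longrightarrow> t \<in> carrier_vec p \<Longrightarrow>
      s \<bullet> (D *\<^sub>v t) = (\<Sum>e\<in>I. (u e \<bullet> s) * (u e \<bullet> t))"
    and hB: "\<And>s t. s \<in> carrier_vec p \<Longrightarrow> t \<in> carrier_vec q \<Longrightarrow>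
      s \<bullet> (B *\<^sub>v t) = (\<Sum>e\<in>I. (u e \<bullet> s) * (v e \<bullet> t))"
    and hL: "\<And>s t. s \<in> carrier_vec q \<Longrightarrow> t \<in> carrier_vec q \<Longrightarrow>
      s \<bullet> (L *\<^sub>v t) = (\<Sum>e\<in>I. (v e \<bullet> s) * (v e \<bullet> t))"
    and s: "s \<in> carrier_vec p"
  shows "s \<bullet> ((D - B * X * B\<^sup>T) *\<^sub>v s)
      = (\<Sum>e\<in>I. (u e \<bullet> s - v e \<bullet> (X *\<^sub>v (B\<^sup>T *\<^sub>v s)))\<^sup>2)" (is ?form)
    and "w \<in> carrier_vec q \<Longrightarrow> (\<And>e. e \<in> I \<Longrightarrow> u e \<bullet> s = v e \<bullet> w)
      \<Longrightarrow> s \<bullet> ((D - B * X * B\<^sup>T) *\<^sub>v s) = 0"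
proof -
  note h = pinv[unfolded is_pseudoinverse_def]
  have X: "X \<in> carrier_mat q q" using conjunct1[OF h] unfolding carrier_matD[OF L] .
  note LXL = h[THEN conjunct2, THEN conjunct1]
  note XLX = h[THEN conjunct2, THEN conjunct2, THEN conjunct1]
  have symX: "X\<^sup>T = X"
    by (rule is_pseudoinverse_unique[OF is_pseudoinverse_transpose[OF pinv, unfolded symL] pinv])
  have BT: "B\<^sup>T \<in> carrier_mat q p" using B by simp
  define b where "b = B\<^sup>T *\<^sub>v s"
  define z where "z = X *\<^sub>v b"
  have b: "b \<in> carrier_vec q" using BT s by (simp add: b_def)
  have z: "z \<in> carrier_vec q" using X b by (simp add: z_def)
  have C: "s \<bullet> ((D - B * X * B\<^sup>T) *\<^sub>v s) = s \<bullet> (D *\<^sub>v s) - s \<bullet> (B *\<^sub>v z)"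
  proof -
    have "(D - B * X * B\<^sup>T) *\<^sub>v s = D *\<^sub>v s - (B * X * B\<^sup>T) *\<^sub>v s"
      using D B X BT s by (intro minus_mult_distrib_mat_vec) auto
    also have "(B * X * B\<^sup>T) *\<^sub>v s = B *\<^sub>v z"
      using assoc_mult_mat_vec[of "B * X" p q "B\<^sup>T" p s] assoc_mult_mat_vec[OF B X b] B X BT s
      by (simp add: b_def z_def)
    finally show ?thesis
      using scalar_prod_minus_distrib[of s p "D *\<^sub>v s" "B *\<^sub>v z"] D B s z by simp
  qed
  have sBz: "s \<bullet> (B *\<^sub>v z) = b \<bullet> z"
    using transpose_vec_mult_scalar[OF B z s] by (simp add: b_def)
  \<comment> \<open>One factor \<open>X\<close> moves to the other side by symmetry, which leaves
    \<open>X * L * X\<close> applied to \<open>b\<close>.\<close>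
  have zLz: "z \<bullet> (L *\<^sub>v z) = b \<bullet> z"
  proof -
    have "z \<bullet> (L *\<^sub>v z) = b \<bullet> (X *\<^sub>v (L *\<^sub>v z))"
      using transpose_vec_mult_scalar[OF X _ b, of "L *\<^sub>v z"] symX L z by (simp add: z_def)
    also have "X *\<^sub>v (L *\<^sub>v z) = (X * L * X) *\<^sub>v b"
      using assoc_mult_mat_vec[of "X * L" q q X q b] assoc_mult_mat_vec[OF X L z] X L b
      by (simp add: z_def)
    finally show ?thesis using XLX by (simp add: z_def)
  qed
  have "(\<Sum>e\<in>I. (u e \<bullet> s - v e \<bullet> z)\<^sup>2)
    = s \<bullet> (D *\<^sub>v s) - 2 * (s \<bullet> (B *\<^sub>v z)) + z \<bullet> (L *\<^sub>v z)"
    using s z by (simp add: hD hB hL power2_eq_square algebra_simps sum.distrib sum_subtractf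
        sum_distrib_left)
  then show ?form using C sBz zLz by (simp add: z_def b_def)
  assume w: "w \<in> carrier_vec q" and eq: "\<And>e. e \<in> I \<Longrightarrow> u e \<bullet> s = v e \<bullet> w"
  \<comment> \<open>Tested on unit vectors, where the exact fit replaces
    \<open>u e \<bullet> s\<close> by \<open>v e \<bullet> w\<close> in the form of \<open>B\<close>
    and so produces the form of \<open>L\<close>.\<close>
  have bw: "b = L *\<^sub>v w"
  proof (rule eq_vecI)
    fix a assume "a < dim_vec (L *\<^sub>v w)"
    then have a: "a < q" using L by simp
    have "b $ a = b \<bullet> unit_vec q a"
      using b a by simp
    also have "\<dots> = s \<bullet> (B *\<^sub>v unit_vec q a)"
      using transpose_vec_mult_scalar[OF B _ s] by (simp add: b_def)
    also have "\<dots> = unit_vec q a \<bullet> (L *\<^sub>v w)"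
      using s w eq by (simp add: hB hL mult.commute)
    also have "\<dots> = (L *\<^sub>v w) $ a"
      using scalar_prod_left_unit[of "L *\<^sub>v w" q a] L w a by simp
    finally show "b $ a = (L *\<^sub>v w) $ a" .
  qed (use b L in simp)
  have "b \<bullet> z = w \<bullet> (L *\<^sub>v z)"
    using transpose_vec_mult_scalar[OF L z w] symL by (simp add: bw)
  also have "L *\<^sub>v z = (L * X * L) *\<^sub>v w"
    using assoc_mult_mat_vec[of "L * X" q q L q w] assoc_mult_mat_vec[OF L X b] X L w
    by (simp add: z_def bw)
  also have "w \<bullet> ((L * X * L) *\<^sub>v w) = s \<bullet> (D *\<^sub>v s)"
    using LXL s w eq by (simp add: hD hL)
  finally show "s \<bullet> ((D - B * X * B\<^sup>T) *\<^sub>v s) = 0" using C sBz by simp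
qed

text \<open>Splits the alignment error into independent scalar problems, one for each coordinate of
  the common space.\<close>

lemma mat_trace_quadratic_form:
  assumes C: "C \<in> carrier_mat p p" and S: "S \<in> carrier_mat p d"
  shows "mat_trace (C * S * S\<^sup>T) = (\<Sum>c<d. col S c \<bullet> (C *\<^sub>v col S c))"
proof -
  have "mat_trace (C * S * S\<^sup>T) = (\<Sum>a<p. \<Sum>c<d. (row C a \<bullet> col S c) * S $$ (a, c))"
    using C S unfolding mat_trace_def
    by (intro sum.cong) (auto simp: scalar_prod_def lessThan_atLeast0 simp del: assoc_mult_mat)
  also have "\<dots> = (\<Sum>c<d. \<Sum>a<p. (row C a \<bullet> col S c) * S $$ (a, c))"
    by (rule sum.swap)
  also have "\<dots> = (\<Sum>c<d. col S c \<bullet> (C *\<^sub>v col S c))"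
    using C S unfolding scalar_prod_def[of "col S _"]
    by (intro sum.cong) (auto simp: lessThan_atLeast0 mult.commute)
  finally show ?thesis .
qed

section \<open>Edge and block vectors, connectedness, well-formedness\<close>

lemma col_mat_outer_index:
  assumes "a < dim_vec u" "b < dim_vec v"
  shows "(col_mat u * (col_mat v)\<^sup>T) $$ (a, b) = u $ a * v $ b"
  using assms by (simp add: col_mat_def scalar_prod_def mat_of_cols_index)

text \<open>A vector instead of a one-column matrix, and indexed by the edge as a pair, so that
  scalar products and sums over \<open>edges\<close> apply directly.\<close>

definition edge_vector :: "patch_framework \<Rightarrow> nat \<times> nat \<Rightarrow> real vec" where
  "edge_vector \<Theta> e = unit_vec (npoints \<Theta> + nviews \<Theta>) (fst e)
     - unit_vec (npoints \<Theta> + nviews \<Theta>) (npoints \<Theta> + snd e)"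

definition block_vector :: "patch_framework \<Rightarrow> nat \<times> nat \<Rightarrow> real vec" where
  "block_vector \<Theta> e = vec (nviews \<Theta> * amb_dim \<Theta>) (\<lambda>a.
     if a div amb_dim \<Theta> = snd e then coord \<Theta> (fst e) (snd e) $ (a mod amb_dim \<Theta>) else 0)"

lemma edge_vector_carrier [simp]:
  "edge_vector \<Theta> e \<in> carrier_vec (npoints \<Theta> + nviews \<Theta>)"
  by (simp add: edge_vector_def)

lemma block_vector_carrier [simp]:
  "block_vector \<Theta> e \<in> carrier_vec (nviews \<Theta> * amb_dim \<Theta>)"
  by (simp add: block_vector_def)

lemma edge_vec_eq: "edge_vec \<Theta> k i = col_mat (edge_vector \<Theta> (k, i))"
  by (simp add: edge_vec_def edge_vector_def)

text \<open>Row \<open>a\<close> of the Kronecker factor is the unit row number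
  \<open>a mod d\<close> if \<open>a div d = i\<close>, and zero otherwise, so the product picks out
  a single coordinate or gives 0.\<close>

lemma block_coord_eq:
  assumes x: "coord \<Theta> k i \<in> carrier_vec (amb_dim \<Theta>)" and "i < nviews \<Theta>"
  shows "block_coord \<Theta> k i = col_mat (block_vector \<Theta> (k, i))"
proof (rule eq_matI)
  define d where "d = amb_dim \<Theta>"
  fix a b assume "a < dim_row (col_mat (block_vector \<Theta> (k, i)))"
    and "b < dim_col (col_mat (block_vector \<Theta> (k, i)))"
  then have a: "a < nviews \<Theta> * d" and b: "b = 0"
    by (auto simp: col_mat_def block_vector_def d_def)
  have d: "d > 0" using a by (cases d) auto
  have ad: "a div d < nviews \<Theta>" using a d by (simp add: less_mult_imp_div_less)
  have "block_coord \<Theta> k i $$ (a, b)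
    = (\<Sum>j\<in>{0..<d}. (if a div d = i then 1 else 0) * (if a mod d = j then 1 else 0) * coord \<Theta> k i $ j)"
    using a b d ad x assms(2) unfolding block_coord_def
    by (auto simp: kronecker_def col_mat_def scalar_prod_def mat_of_cols_index d_def[symmetric]
        intro!: sum.cong)
  also have "\<dots> = (\<Sum>j\<in>{0..<d}. if a mod d = j then (if a div d = i then coord \<Theta> k i $ j else 0) else 0)"
    by (intro sum.cong) auto
  also have "\<dots> = (if a div d = i then coord \<Theta> k i $ (a mod d) else 0)"
    using d by simp
  finally show "block_coord \<Theta> k i $$ (a, b) = col_mat (block_vector \<Theta> (k, i)) $$ (a, b)"
    using a b by (simp add: col_mat_def block_vector_def mat_of_cols_index d_def)
qed (auto simp: block_coord_def kronecker_def col_mat_def block_vector_def)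

lemma edge_vector_scalar_prod:
  assumes "k < npoints \<Theta>" "i < nviews \<Theta>" "x \<in> carrier_vec (npoints \<Theta> + nviews \<Theta>)"
  shows "edge_vector \<Theta> (k, i) \<bullet> x = x $ k - x $ (npoints \<Theta> + i)"
  using assms unfolding edge_vector_def
  by (simp add: minus_scalar_prod_distrib[of _ "npoints \<Theta> + nviews \<Theta>"])

lemma block_vector_scalar_prod:
  assumes i: "i < nviews \<Theta>" and s: "s \<in> carrier_vec (nviews \<Theta> * amb_dim \<Theta>)"
  shows "block_vector \<Theta> (k, i) \<bullet> s
    = (\<Sum>b<amb_dim \<Theta>. coord \<Theta> k i $ b * s $ (i * amb_dim \<Theta> + b))"
proof -
  define d where "d = amb_dim \<Theta>"
  \<comment> \<open>The rows of the block of view \<open>i\<close>; outside them the block vector is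
    zero.\<close>
  define A where "A = (\<lambda>b. i * d + b) ` {..<d}"
  have le: "i * d + b < nviews \<Theta> * d" if "b < d" for b
    using mult_le_mono1[of "Suc i" "nviews \<Theta>" d] i that by simp
  have "block_vector \<Theta> (k, i) \<bullet> s
    = (\<Sum>a\<in>{0..<nviews \<Theta> * d}. (if a div d = i then coord \<Theta> k i $ (a mod d) else 0) * s $ a)"
    using s unfolding d_def by (simp add: block_vector_def scalar_prod_def cong: if_cong)
  also have "\<dots> = (\<Sum>a\<in>A. coord \<Theta> k i $ (a mod d) * s $ a)"
  proof (rule sum.mono_neutral_cong_right)
    show "A \<subseteq> {0..<nviews \<Theta> * d}" using le by (auto simp: A_def)
    have "a \<in> A" if "a < nviews \<Theta> * d" "a div d = i" for a
    proof -
      have "d > 0" using that by (cases d) auto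
      then have "a = i * d + a mod d" "a mod d < d" using that by auto
      then show ?thesis unfolding A_def by blast
    qed
    then show "\<forall>a\<in>{0..<nviews \<Theta> * d} - A.
        (if a div d = i then coord \<Theta> k i $ (a mod d) else 0) * s $ a = 0"
      by auto
  qed (auto simp: A_def)
  also have "\<dots> = (\<Sum>b<d. coord \<Theta> k i $ b * s $ (i * d + b))"
    unfolding A_def by (subst sum.reindex) (auto intro: inj_onI)
  finally show ?thesis by (simp add: d_def)
qed

text \<open>\<open>connected\<close> is strong connectivity of the symmetric closure. Induction
  along a path in it carries the value of \<open>f\<close>, since every arc is an edge in one of its
  two orientations.\<close>

lemma const_on_connected:
  assumes conn: "Digraph_Component.connected (with_proj (patch_graph \<Theta>))"
    and edge: "\<And>k i. (k, i) \<in> edges \<Theta> \<Longrightarrow> f k = f (npoints \<Theta> + i)"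
    and "u < npoints \<Theta> + nviews \<Theta>" "v < npoints \<Theta> + nviews \<Theta>"
  shows "f u = f v"
proof -
  have "u \<rightarrow>\<^sup>*\<^bsub>with_proj (mk_symmetric (with_proj (patch_graph \<Theta>)))\<^esub> v"
    using conn assms(3,4)
    by (auto simp: connected_def strongly_connected_def mk_symmetric_def patch_graph_def)
  then show ?thesis
    unfolding reachable_def
  proof (induction rule: rtrancl_on_induct)
    case (step x y)
    then have "f x = f y"
      using edge by (auto simp: mk_symmetric_def patch_graph_def)
    then show ?case using step by simp
  qed simp
qed

lemma finite_edges: "wf_patch_framework \<Theta> \<Longrightarrow> finite (edges \<Theta>)"
  unfolding wf_patch_framework_def by (meson finite_SigmaI finite_lessThan finite_subset)

lemma wf_edge:
  assumes "wf_patch_framework \<Theta>" "(k, i) \<in> edges \<Theta>"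
  shows "k < npoints \<Theta>" "i < nviews \<Theta>" "coord \<Theta> k i \<in> carrier_vec (amb_dim \<Theta>)"
  using assms unfolding wf_patch_framework_def by auto

section \<open>The Laplacian and the quadratic form of \<open>C_mat\<close>\<close>

lemma laplacian_bilinear:
  assumes wf: "wf_patch_framework \<Theta>"
    and s: "s \<in> carrier_vec (npoints \<Theta> + nviews \<Theta>)" and t: "t \<in> carrier_vec (npoints \<Theta> + nviews \<Theta>)"
  shows "s \<bullet> (laplacian \<Theta> *\<^sub>v t) = (\<Sum>e\<in>edges \<Theta>. (edge_vector \<Theta> e \<bullet> s) * (edge_vector \<Theta> e \<bullet> t))"
  unfolding laplacian_def
  by (rule scalar_prod_mat_sum_mult[OF _ _ _ s t])
    (auto simp: edge_vec_eq col_mat_outer_index carrier_vecD[OF edge_vector_carrier])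

lemma B_mat_bilinear:
  assumes wf: "wf_patch_framework \<Theta>"
    and s: "s \<in> carrier_vec (nviews \<Theta> * amb_dim \<Theta>)" and t: "t \<in> carrier_vec (npoints \<Theta> + nviews \<Theta>)"
  shows "s \<bullet> (B_mat \<Theta> *\<^sub>v t) = (\<Sum>e\<in>edges \<Theta>. (block_vector \<Theta> e \<bullet> s) * (edge_vector \<Theta> e \<bullet> t))"
  unfolding B_mat_def
  by (rule scalar_prod_mat_sum_mult[OF _ _ _ s t])
    (auto simp: edge_vec_eq block_coord_eq wf_edge[OF wf] col_mat_outer_index
      carrier_vecD[OF edge_vector_carrier] carrier_vecD[OF block_vector_carrier])

lemma D_mat_bilinear:
  assumes wf: "wf_patch_framework \<Theta>"
    and s: "s \<in> carrier_vec (nviews \<Theta> * amb_dim \<Theta>)" and t: "t \<in> carrier_vec (nviews \<Theta> * amb_dim \<Theta>)"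
  shows "s \<bullet> (D_mat \<Theta> *\<^sub>v t) = (\<Sum>e\<in>edges \<Theta>. (block_vector \<Theta> e \<bullet> s) * (block_vector \<Theta> e \<bullet> t))"
  unfolding D_mat_def
  by (rule scalar_prod_mat_sum_mult[OF _ _ _ s t])
    (auto simp: block_coord_eq wf_edge[OF wf] col_mat_outer_index carrier_vecD[OF block_vector_carrier])

lemma laplacian_carrier [simp]:
  "laplacian \<Theta> \<in> carrier_mat (npoints \<Theta> + nviews \<Theta>) (npoints \<Theta> + nviews \<Theta>)"
  by (simp add: laplacian_def)

lemma transpose_laplacian: "(laplacian \<Theta>)\<^sup>T = laplacian \<Theta>"
  unfolding laplacian_def mat_sum_def
  by (rule eq_matI)
    (auto intro!: sum.cong simp: edge_vec_eq col_mat_outer_index carrier_vecD[OF edge_vector_carrier])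

text \<open>\<open>pseudoinverse\<close> is a definite description, so existence has to be shown
  first. A vanishing Laplacian form makes all edge differences zero, and connectedness then leaves
  only the constant vectors.\<close>

lemma is_pseudoinverse_laplacian:
  assumes wf: "wf_patch_framework \<Theta>"
    and conn: "Digraph_Component.connected (with_proj (patch_graph \<Theta>))"
  shows "is_pseudoinverse (laplacian \<Theta>) (pseudoinverse (laplacian \<Theta>))"
proof -
  define N where "N = npoints \<Theta> + nviews \<Theta>"
  note bil = laplacian_bilinear[OF wf, folded N_def]
  note L = laplacian_carrier[of \<Theta>, folded N_def]
  note edge = edge_vector_scalar_prod[of _ \<Theta>, folded N_def]
  have "\<exists>X. is_pseudoinverse (laplacian \<Theta>) X"
  proof (rule pseudoinverse_from_ones[OF L transpose_laplacian])
    show "laplacian \<Theta> *\<^sub>v vec N (\<lambda>_. 1) = 0\<^sub>v N"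
    proof (rule eq_vecI)
      fix a assume "a < dim_vec (0\<^sub>v N :: real vec)"
      then have a: "a < N" by simp
      have "(laplacian \<Theta> *\<^sub>v vec N (\<lambda>_. 1)) $ a = unit_vec N a \<bullet> (laplacian \<Theta> *\<^sub>v vec N (\<lambda>_. 1))"
        using a L by (subst scalar_prod_left_unit) auto
      also have "\<dots> = 0"
      proof -
        have "edge_vector \<Theta> e \<bullet> vec N (\<lambda>_. 1) = 0" if "e \<in> edges \<Theta>" for e
          using that wf_edge[OF wf, of "fst e" "snd e"] edge[of "fst e" "snd e" "vec N (\<lambda>_. 1)"]
          by (simp add: N_def)
        then show ?thesis by (simp add: bil)
      qed
      finally show "(laplacian \<Theta> *\<^sub>v vec N (\<lambda>_. 1)) $ a = 0\<^sub>v N $ a" using a by simp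
    qed (use L in simp)
  next
    fix x :: "real vec" assume x: "x \<in> carrier_vec N"
    show "x \<bullet> (laplacian \<Theta> *\<^sub>v x) \<ge> 0"
      using x by (simp add: bil sum_nonneg)
    assume "x \<bullet> (laplacian \<Theta> *\<^sub>v x) = 0"
    then have "(\<Sum>e\<in>edges \<Theta>. (edge_vector \<Theta> e \<bullet> x) * (edge_vector \<Theta> e \<bullet> x)) = 0"
      using x by (simp add: bil)
    then have "edge_vector \<Theta> e \<bullet> x = 0" if "e \<in> edges \<Theta>" for e
      using that finite_edges[OF wf] by (subst (asm) sum_nonneg_eq_0_iff) auto
    then have "x $ k = x $ (npoints \<Theta> + i)" if "(k, i) \<in> edges \<Theta>" for k i
      using that wf_edge[OF wf that] edge[of k i x] x by fastforce
    then show "\<forall>i<N. \<forall>j<N. x $ i = x $ j"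
      using const_on_connected[OF conn, of "\<lambda>i. x $ i"] unfolding N_def by blast
  qed
  then show ?thesis using pseudoinverse_eq by metis
qed

text \<open>The form is the sum over the edges of the squared residuals at \<open>z\<close>. If it
  vanishes, \<open>z\<close> itself is an exact fit; conversely an exact fit makes it vanish by the
  second claim of \<open>residual_quadratic_form\<close>.\<close>

lemma C_mat_quadratic_form:
  assumes wf: "wf_patch_framework \<Theta>"
    and conn: "Digraph_Component.connected (with_proj (patch_graph \<Theta>))"
    and s: "s \<in> carrier_vec (nviews \<Theta> * amb_dim \<Theta>)"
  shows "s \<bullet> (C_mat \<Theta> *\<^sub>v s) \<ge> 0"
    and "s \<bullet> (C_mat \<Theta> *\<^sub>v s) = 0 \<longleftrightarrow> (\<exists>w\<in>carrier_vec (npoints \<Theta> + nviews \<Theta>).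
      \<forall>(k, i)\<in>edges \<Theta>. block_vector \<Theta> (k, i) \<bullet> s = w $ k - w $ (npoints \<Theta> + i))"
proof -
  define X where "X = pseudoinverse (laplacian \<Theta>)"
  define z where "z = X *\<^sub>v ((B_mat \<Theta>)\<^sup>T *\<^sub>v s)"
  note pinv = is_pseudoinverse_laplacian[OF wf conn, folded X_def]
  have D: "D_mat \<Theta> \<in> carrier_mat (nviews \<Theta> * amb_dim \<Theta>) (nviews \<Theta> * amb_dim \<Theta>)"
    and B: "B_mat \<Theta> \<in> carrier_mat (nviews \<Theta> * amb_dim \<Theta>) (npoints \<Theta> + nviews \<Theta>)"
    by (simp_all add: D_mat_def B_mat_def)
  note res = residual_quadratic_form[OF pinv D B laplacian_carrier transpose_laplacian D_mat_bilinear[OF wf]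
      B_mat_bilinear[OF wf] laplacian_bilinear[OF wf] s, folded C_mat_def[of \<Theta>, folded X_def]]
  have form: "s \<bullet> (C_mat \<Theta> *\<^sub>v s) = (\<Sum>e\<in>edges \<Theta>. (block_vector \<Theta> e \<bullet> s - edge_vector \<Theta> e \<bullet> z)\<^sup>2)"
    unfolding z_def by (rule res(1))
  have zero: "s \<bullet> (C_mat \<Theta> *\<^sub>v s) = 0" if "w \<in> carrier_vec (npoints \<Theta> + nviews \<Theta>)"
    and "\<And>e. e \<in> edges \<Theta> \<Longrightarrow> block_vector \<Theta> e \<bullet> s = edge_vector \<Theta> e \<bullet> w" for w
    by (rule res(2)) (assumption | rule that)+
  have z: "z \<in> carrier_vec (npoints \<Theta> + nviews \<Theta>)"
    using conjunct1[OF pinv[unfolded is_pseudoinverse_def]] laplacian_carrier[of \<Theta>]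
    unfolding z_def by (metis carrier_matD(1) carrier_matD(2) carrier_vec_dim_vec dim_mult_mat_vec)
  show "s \<bullet> (C_mat \<Theta> *\<^sub>v s) \<ge> 0" unfolding form by (simp add: sum_nonneg)
  show "s \<bullet> (C_mat \<Theta> *\<^sub>v s) = 0 \<longleftrightarrow> (\<exists>w\<in>carrier_vec (npoints \<Theta> + nviews \<Theta>).
      \<forall>(k, i)\<in>edges \<Theta>. block_vector \<Theta> (k, i) \<bullet> s = w $ k - w $ (npoints \<Theta> + i))"
    (is "?l \<longleftrightarrow> ?r")
  proof
    assume ?l
    then have "block_vector \<Theta> e \<bullet> s = edge_vector \<Theta> e \<bullet> z" if "e \<in> edges \<Theta>" for e
      using that finite_edges[OF wf] unfolding form by (subst (asm) sum_nonneg_eq_0_iff) auto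
    then show ?r
      using z wf_edge[OF wf] edge_vector_scalar_prod[OF _ _ z] by (intro bexI[of _ z]) auto
  next
    assume ?r
    then obtain w where w: "w \<in> carrier_vec (npoints \<Theta> + nviews \<Theta>)"
      and eq: "\<And>k i. (k, i) \<in> edges \<Theta> \<Longrightarrow> block_vector \<Theta> (k, i) \<bullet> s = w $ k - w $ (npoints \<Theta> + i)"
      by blast
    show ?l
    proof (rule zero[OF w])
      fix e assume "e \<in> edges \<Theta>"
      then show "block_vector \<Theta> e \<bullet> s = edge_vector \<Theta> e \<bullet> w"
        using eq wf_edge[OF wf] edge_vector_scalar_prod[OF _ _ w] by (cases e) auto
    qed
  qed
qed

section \<open>Alignments of zero error\<close>

lemma stack_carrier [simp]: "stack m d Ss \<in> carrier_mat (m * d) d"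
  by (simp add: stack_def)

text \<open>Column \<open>c\<close> of the stack carries column \<open>c\<close> of
  \<open>Ss i\<close> in block \<open>i\<close>, the only block that the block vector sees.\<close>

lemma block_vector_stack_col:
  assumes i: "i < nviews \<Theta>" and c: "c < amb_dim \<Theta>"
    and x: "coord \<Theta> k i \<in> carrier_vec (amb_dim \<Theta>)"
    and Ss: "Ss i \<in> carrier_mat (amb_dim \<Theta>) (amb_dim \<Theta>)"
  shows "block_vector \<Theta> (k, i) \<bullet> col (stack (nviews \<Theta>) (amb_dim \<Theta>) Ss) c
    = ((Ss i)\<^sup>T *\<^sub>v coord \<Theta> k i) $ c"
proof -
  define d where "d = amb_dim \<Theta>"
  have le: "i * d + b < nviews \<Theta> * d" if "b < d" for b
    using mult_le_mono1[of "Suc i" "nviews \<Theta>" d] i that by simp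
  have col: "col (stack (nviews \<Theta>) d Ss) c \<in> carrier_vec (nviews \<Theta> * d)"
    using stack_carrier[of "nviews \<Theta>" d Ss] by (metis carrier_matD(1) col_dim)
  have "block_vector \<Theta> (k, i) \<bullet> col (stack (nviews \<Theta>) d Ss) c
    = (\<Sum>b<d. coord \<Theta> k i $ b * Ss i $$ (b, c))"
    unfolding block_vector_scalar_prod[OF i col[unfolded d_def], folded d_def]
    using le c by (intro sum.cong refl) (simp add: stack_def d_def)
  also have "\<dots> = ((Ss i)\<^sup>T *\<^sub>v coord \<Theta> k i) $ c"
    using x Ss c by (simp add: scalar_prod_def d_def lessThan_atLeast0 mult.commute)
  finally show ?thesis by (simp add: d_def)
qed

text \<open>Each column is a scalar problem of its own. The fits of all columns, read together, are
  the coordinates of points \<open>z k\<close> and translations \<open>t i\<close>: values at point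
  vertices give the points, values at view vertices the translations.\<close>

lemma alignment_error_stack:
  assumes wf: "wf_patch_framework \<Theta>"
    and conn: "Digraph_Component.connected (with_proj (patch_graph \<Theta>))"
    and Ss: "\<And>i. i < nviews \<Theta> \<Longrightarrow> Ss i \<in> carrier_mat (amb_dim \<Theta>) (amb_dim \<Theta>)"
  shows "alignment_error \<Theta> (stack (nviews \<Theta>) (amb_dim \<Theta>) Ss) \<ge> 0"
    and "alignment_error \<Theta> (stack (nviews \<Theta>) (amb_dim \<Theta>) Ss) = 0 \<longleftrightarrow>
      (\<exists>z t. (\<forall>k. z k \<in> carrier_vec (amb_dim \<Theta>)) \<and> (\<forall>i. t i \<in> carrier_vec (amb_dim \<Theta>)) \<and>
        (\<forall>(k, i)\<in>edges \<Theta>. (Ss i)\<^sup>T *\<^sub>v coord \<Theta> k i = z k - t i))" (is "?l \<longleftrightarrow> ?r")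
proof -
  define d where "d = amb_dim \<Theta>"
  define S where "S = stack (nviews \<Theta>) d Ss"
  have S: "S \<in> carrier_mat (nviews \<Theta> * d) d" by (simp add: S_def)
  have C: "C_mat \<Theta> \<in> carrier_mat (nviews \<Theta> * d) (nviews \<Theta> * d)"
    unfolding C_mat_def B_mat_def D_mat_def mat_sum_def by (auto simp: d_def)
  have col: "col S c \<in> carrier_vec (nviews \<Theta> * amb_dim \<Theta>)" for c
    using S by (metis carrier_matD(1) col_dim d_def)
  note Q = C_mat_quadratic_form[OF wf conn col]
  have F: "alignment_error \<Theta> S = (\<Sum>c<d. col S c \<bullet> (C_mat \<Theta> *\<^sub>v col S c))"
    unfolding alignment_error_def by (rule mat_trace_quadratic_form[OF C S])
  show "alignment_error \<Theta> (stack (nviews \<Theta>) (amb_dim \<Theta>) Ss) \<ge> 0"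
    using Q(1) F by (simp add: S_def d_def sum_nonneg)
  have blk: "block_vector \<Theta> (k, i) \<bullet> col S c = ((Ss i)\<^sup>T *\<^sub>v coord \<Theta> k i) $ c"
    if "(k, i) \<in> edges \<Theta>" "c < d" for k i c
    using block_vector_stack_col wf_edge[OF wf that(1)] Ss that(2) unfolding S_def d_def by blast
  have "alignment_error \<Theta> S = 0 \<longleftrightarrow> (\<forall>c<d. col S c \<bullet> (C_mat \<Theta> *\<^sub>v col S c) = 0)"
    unfolding F using Q(1) by (subst sum_nonneg_eq_0_iff) auto
  also have "\<dots> \<longleftrightarrow> (\<forall>c<d. \<exists>w\<in>carrier_vec (npoints \<Theta> + nviews \<Theta>).
    \<forall>(k, i)\<in>edges \<Theta>. ((Ss i)\<^sup>T *\<^sub>v coord \<Theta> k i) $ c = w $ k - w $ (npoints \<Theta> + i))"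
    unfolding Q(2)
    by (intro all_cong bex_cong ball_cong refl) (clarsimp simp: blk simp del: index_mult_mat_vec)
  also have "\<dots> \<longleftrightarrow> ?r"
  proof
    assume "\<forall>c<d. \<exists>w\<in>carrier_vec (npoints \<Theta> + nviews \<Theta>).
      \<forall>(k, i)\<in>edges \<Theta>. ((Ss i)\<^sup>T *\<^sub>v coord \<Theta> k i) $ c = w $ k - w $ (npoints \<Theta> + i)"
    \<comment> \<open>The bound on \<open>c\<close> moves under the existential quantifier, so that
      \<open>choice\<close> yields one fit for each column.\<close>
    then have "\<forall>c. \<exists>w. c < d \<longrightarrow> (\<forall>(k, i)\<in>edges \<Theta>.
      ((Ss i)\<^sup>T *\<^sub>v coord \<Theta> k i) $ c = w $ k - w $ (npoints \<Theta> + i))" by blast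
    from choice[OF this] obtain w where w: "\<And>c k i. c < d \<Longrightarrow> (k, i) \<in> edges \<Theta> \<Longrightarrow>
      ((Ss i)\<^sup>T *\<^sub>v coord \<Theta> k i) $ c = w c $ k - w c $ (npoints \<Theta> + i)"
      by blast
    have "(Ss i)\<^sup>T *\<^sub>v coord \<Theta> k i = vec d (\<lambda>c. w c $ k) - vec d (\<lambda>c. w c $ (npoints \<Theta> + i))"
      if "(k, i) \<in> edges \<Theta>" for k i
      using w[OF _ that] Ss wf_edge[OF wf that] by (intro eq_vecI) (auto simp: d_def)
    then show ?r
      by (intro exI[of _ "\<lambda>k. vec d (\<lambda>c. w c $ k)"]
          exI[of _ "\<lambda>i. vec d (\<lambda>c. w c $ (npoints \<Theta> + i))"]) (auto simp: d_def)
  next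
    assume ?r
    then obtain z t where z: "\<And>k. z k \<in> carrier_vec d" and t: "\<And>i. t i \<in> carrier_vec d"
      and eq: "\<And>k i. (k, i) \<in> edges \<Theta> \<Longrightarrow> (Ss i)\<^sup>T *\<^sub>v coord \<Theta> k i = z k - t i"
      unfolding d_def by blast
    show "\<forall>c<d. \<exists>w\<in>carrier_vec (npoints \<Theta> + nviews \<Theta>).
      \<forall>(k, i)\<in>edges \<Theta>. ((Ss i)\<^sup>T *\<^sub>v coord \<Theta> k i) $ c = w $ k - w $ (npoints \<Theta> + i)"
    proof (intro allI impI)
      fix c assume c: "c < d"
      \<comment> \<open>The scalar fit of column \<open>c\<close>: coordinate \<open>c\<close> of
        the point or of the translation, according to the kind of vertex.\<close>
      define w where "w = vec (npoints \<Theta> + nviews \<Theta>)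
        (\<lambda>a. if a < npoints \<Theta> then z a $ c else t (a - npoints \<Theta>) $ c)"
      have "((Ss i)\<^sup>T *\<^sub>v coord \<Theta> k i) $ c = w $ k - w $ (npoints \<Theta> + i)"
        if "(k, i) \<in> edges \<Theta>" for k i
        using eq[OF that] wf_edge[OF wf that] t[of i] c by (simp add: w_def)
      moreover have "w \<in> carrier_vec (npoints \<Theta> + nviews \<Theta>)" by (simp add: w_def)
      ultimately show "\<exists>w\<in>carrier_vec (npoints \<Theta> + nviews \<Theta>).
        \<forall>(k, i)\<in>edges \<Theta>. ((Ss i)\<^sup>T *\<^sub>v coord \<Theta> k i) $ c = w $ k - w $ (npoints \<Theta> + i)"
        by (intro bexI[of _ w]) auto
    qed
  qed
  finally show "?l \<longleftrightarrow> ?r" by (simp add: S_def d_def)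
qed

section \<open>Rank of the centred overlap\<close>

text \<open>Full rank means that the columns span the space. A vector killed by
  \<open>M\<^sup>T\<close> is orthogonal to all columns, hence to itself if they span. Conversely,
  if only 0 is killed, then \<open>M * M\<^sup>T\<close> has an inverse \<open>W\<close>, and
  \<open>M\<^sup>T *\<^sub>v (W *\<^sub>v y)\<close> is a preimage of \<open>y\<close>.\<close>

lemma rank_full_iff:
  fixes M :: "real mat"
  assumes M: "M \<in> carrier_mat d nc"
  shows "vec_space.rank d M = d \<longleftrightarrow> (\<forall>u\<in>carrier_vec d. M\<^sup>T *\<^sub>v u = 0\<^sub>v nc \<longrightarrow> u = 0\<^sub>v d)"
    (is "?l \<longleftrightarrow> ?r")
proof -
  interpret vec_space "TYPE(real)" d .
  have MT: "M\<^sup>T \<in> carrier_mat nc d" using M by simp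
  have cols: "set (cols M) \<subseteq> carrier_vec d" using cols_dim[of M] M by auto
  have span: "span (set (cols M)) = {y\<in>carrier_vec d. \<exists>x\<in>carrier_vec nc. M *\<^sub>v x = y}"
    using col_space_eq[OF M] M unfolding col_space_def by simp
  have full: "rank M = d \<longleftrightarrow> span (set (cols M)) = carrier_vec d"
  proof
    assume r: "rank M = d"
    \<comment> \<open>The rank is the size of a maximal independent set of columns; with
      \<open>d\<close> elements such a set is a basis.\<close>
    obtain B where B: "finite B" "maximal B (\<lambda>T. T \<subseteq> set (cols M) \<and> lin_indpt T)"
      using maximal_exists_superset[of "set (cols M)" "\<lambda>T. T \<subseteq> set (cols M) \<and> lin_indpt T" "{}"]
      by (auto simp: lin_dep_def)
    have card: "card B = d" using rank_card_indpt[OF M B(2)] r by simp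
    have sub: "B \<subseteq> set (cols M)" and li: "lin_indpt B" using B(2) unfolding maximal_def by auto
    have "basis B"
      using sub cols li card by (intro dim_li_is_basis B) (auto simp: dim_is_n)
    then have "carrier_vec d \<subseteq> span (set (cols M))"
      using span_is_monotone[OF sub] unfolding basis_def by auto
    then show "span (set (cols M)) = carrier_vec d" using span by blast
  next
    assume "span (set (cols M)) = carrier_vec d"
    then have "span_vs (set (cols M)) = module_vec TYPE(real) d"
      by (simp add: module_vec_def)
    then show "rank M = d" unfolding rank_def using dim_is_n by simp
  qed
  show ?thesis
  proof
    assume ?l
    show ?r
    proof (intro ballI impI)
      fix u :: "real vec" assume u: "u \<in> carrier_vec d" and 0: "M\<^sup>T *\<^sub>v u = 0\<^sub>v nc"
      obtain x where x: "x \<in> carrier_vec nc" "M *\<^sub>v x = u"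
        using \<open>?l\<close> full span u by auto
      have "u \<bullet> u = (M\<^sup>T *\<^sub>v u) \<bullet> x"
        using transpose_vec_mult_scalar[OF M x(1) u] x(2) by simp
      then show "u = 0\<^sub>v d" using 0 x u by (intro scalar_prod_eq_0_real) auto
    qed
  next
    assume r: ?r
    have MM: "M * M\<^sup>T \<in> carrier_mat d d" using M by simp
    have "u = 0\<^sub>v d" if u: "u \<in> carrier_vec d" and 0: "(M * M\<^sup>T) *\<^sub>v u = 0\<^sub>v d" for u
    proof -
      have MTu: "M\<^sup>T *\<^sub>v u \<in> carrier_vec nc" using MT u by simp
      have "(M\<^sup>T *\<^sub>v u) \<bullet> (M\<^sup>T *\<^sub>v u) = u \<bullet> ((M * M\<^sup>T) *\<^sub>v u)"
        using transpose_vec_mult_scalar[OF M MTu u] assoc_mult_mat_vec[OF M MT u] by simp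
      then have "M\<^sup>T *\<^sub>v u = 0\<^sub>v nc"
        using 0 u MTu by (intro scalar_prod_eq_0_real) auto
      then show ?thesis using r u by blast
    qed
    then obtain W where W: "W \<in> carrier_mat d d" "M * M\<^sup>T * W = 1\<^sub>m d"
      using obtain_inverse_mat[OF MM] by blast
    have "y \<in> span (set (cols M))" if y: "y \<in> carrier_vec d" for y
    proof -
      have Wy: "W *\<^sub>v y \<in> carrier_vec d" using W(1) y by simp
      have "M *\<^sub>v (M\<^sup>T *\<^sub>v (W *\<^sub>v y)) = (M * M\<^sup>T * W) *\<^sub>v y"
        using assoc_mult_mat_vec[OF MM W(1) y] assoc_mult_mat_vec[OF M MT Wy] by simp
      then have "M *\<^sub>v (M\<^sup>T *\<^sub>v (W *\<^sub>v y)) = y" using W(2) y by simp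
      moreover have "M\<^sup>T *\<^sub>v (W *\<^sub>v y) \<in> carrier_vec nc" using MT Wy by simp
      ultimately show ?thesis using y unfolding span by blast
    qed
    then show ?l using full span by blast
  qed
qed

text \<open>The centring matrix is symmetric and subtracts the mean, so the product vanishes iff all
  values \<open>u \<bullet> col B j\<close> equal their mean. For \<open>n = 0\<close>, where
  \<open>1 / real n\<close> is 0, both sides hold trivially.\<close>

lemma centered_mat_kernel:
  fixes B :: "real mat" and u :: "real vec" and n :: nat
  defines "ones \<equiv> col_mat (vec n (\<lambda>_. 1))"
  assumes B: "B \<in> carrier_mat d n" and u: "u \<in> carrier_vec d"
  shows "(B * (1\<^sub>m n - (1 / real n) \<cdot>\<^sub>m (ones * ones\<^sup>T)))\<^sup>T *\<^sub>v u = 0\<^sub>v n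
    \<longleftrightarrow> (\<exists>c. \<forall>j<n. u \<bullet> col B j = c)" (is "(B * ?P)\<^sup>T *\<^sub>v u = _ \<longleftrightarrow> ?r")
proof -
  define y where "y = B\<^sup>T *\<^sub>v u"
  have y: "y \<in> carrier_vec n" using mult_mat_vec_carrier[of "B\<^sup>T" n d u] B u by (simp add: y_def)
  have yj: "y $ j = u \<bullet> col B j" if "j < n" for j
    using that B u by (simp add: y_def comm_scalar_prod[OF u, of "col B j"])
  have P: "?P = mat n n (\<lambda>(a, b). (if a = b then 1 else 0) - 1 / real n)"
    by (rule eq_matI) (auto simp: ones_def col_mat_def scalar_prod_def mat_of_cols_index)
  have PT: "?P\<^sup>T = ?P" unfolding P by (rule eq_matI) auto
  have Pc: "?P \<in> carrier_mat n n" unfolding P by simp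
  have "(B * ?P)\<^sup>T *\<^sub>v u = ?P *\<^sub>v y"
    using B u Pc PT transpose_mult[OF B Pc] assoc_mult_mat_vec[OF Pc, of "B\<^sup>T" d u]
    by (simp add: y_def)
  also have "?P *\<^sub>v y = vec n (\<lambda>a. y $ a - (\<Sum>b\<in>{0..<n}. y $ b) / real n)"
  proof (rule eq_vecI)
    fix a assume "a < dim_vec (vec n (\<lambda>a. y $ a - (\<Sum>b\<in>{0..<n}. y $ b) / real n))"
    then have a: "a < n" by simp
    have "(?P *\<^sub>v y) $ a = (\<Sum>b\<in>{0..<n}. (if a = b then y $ b else 0) - y $ b / real n)"
      using a y unfolding P by (auto simp: scalar_prod_def algebra_simps intro!: sum.cong)
    then show "(?P *\<^sub>v y) $ a = vec n (\<lambda>a. y $ a - (\<Sum>b\<in>{0..<n}. y $ b) / real n) $ a"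
      using a by (simp add: sum_subtractf sum_divide_distrib)
  qed (simp add: P)
  finally have eq: "(B * ?P)\<^sup>T *\<^sub>v u = vec n (\<lambda>a. y $ a - (\<Sum>b\<in>{0..<n}. y $ b) / real n)" .
  show ?thesis
  proof
    assume "(B * ?P)\<^sup>T *\<^sub>v u = 0\<^sub>v n"
    then have 0: "vec n (\<lambda>a. y $ a - (\<Sum>b\<in>{0..<n}. y $ b) / real n) = 0\<^sub>v n"
      using eq by simp
    have "u \<bullet> col B j = (\<Sum>b\<in>{0..<n}. y $ b) / real n" if "j < n" for j
      using arg_cong[OF 0, of "\<lambda>v. v $ j"] that yj[OF that] by simp
    then show ?r by blast
  next
    assume ?r
    then obtain c where c: "\<And>j. j < n \<Longrightarrow> y $ j = c" using yj by metis
    have "(\<Sum>b\<in>{0..<n}. y $ b) = (\<Sum>b\<in>{0..<n}. c)"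
      by (rule sum.cong) (use c in auto)
    then show "(B * ?P)\<^sup>T *\<^sub>v u = 0\<^sub>v n"
      unfolding eq using c by (intro eq_vecI) auto
  qed
qed

lemma rank_centered_overlap_mat_iff:
  assumes wf: "wf_patch_framework \<Theta>"
  shows "vec_space.rank (amb_dim \<Theta>) (centered_overlap_mat \<Theta> i j) = amb_dim \<Theta> \<longleftrightarrow>
    (\<forall>u\<in>carrier_vec (amb_dim \<Theta>).
      (\<exists>c. \<forall>k\<in>view_points \<Theta> i \<inter> view_points \<Theta> j. u \<bullet> coord \<Theta> k i = c) \<longrightarrow> u = 0\<^sub>v (amb_dim \<Theta>))"
proof -
  define d where "d = amb_dim \<Theta>"
  define V where "V = view_points \<Theta> i \<inter> view_points \<Theta> j"
  define ks where "ks = sorted_list_of_set V"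
  define n where "n = length ks"
  \<comment> \<open>Finiteness matters because \<open>sorted_list_of_set\<close> returns the empty
    list on infinite sets.\<close>
  have "V \<subseteq> fst ` edges \<Theta>" by (force simp: V_def view_points_def)
  then have "finite V" using finite_edges[OF wf] finite_subset by blast
  then have set_ks: "set ks = V" by (simp add: ks_def)
  define B where "B = overlap_mat \<Theta> i j"
  have B_eq: "B = mat_of_cols d (map (\<lambda>k. coord \<Theta> k i) ks)"
    by (simp add: B_def overlap_mat_def d_def V_def ks_def)
  have B: "B \<in> carrier_mat d n" unfolding B_eq by (auto simp: n_def)
  have col_B: "col B l = coord \<Theta> (ks ! l) i" if "l < n" for l
  proof -
    have "ks ! l \<in> V" using that set_ks by (auto simp: n_def)
    then have "coord \<Theta> (ks ! l) i \<in> carrier_vec d"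
      using wf_edge(3)[OF wf] by (auto simp: V_def view_points_def d_def)
    then show ?thesis using that unfolding B_eq by (simp add: n_def)
  qed
  define M where "M = centered_overlap_mat \<Theta> i j"
  have M: "M = B * (1\<^sub>m n - (1 / real n) \<cdot>\<^sub>m (col_mat (vec n (\<lambda>_. 1)) * (col_mat (vec n (\<lambda>_. 1)))\<^sup>T))"
    using carrier_matD(2)[OF B] by (simp add: M_def centered_overlap_mat_def Let_def B_def)
  have Mc: "M \<in> carrier_mat d n" unfolding M using B by (auto simp: col_mat_def)
  have "(M\<^sup>T *\<^sub>v u = 0\<^sub>v n) = (\<exists>c. \<forall>k\<in>V. u \<bullet> coord \<Theta> k i = c)" if u: "u \<in> carrier_vec d" for u
  proof -
    have "(\<forall>l<n. u \<bullet> col B l = c) \<longleftrightarrow> (\<forall>k\<in>V. u \<bullet> coord \<Theta> k i = c)" for c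
      unfolding set_ks[symmetric] all_set_conv_all_nth n_def[symmetric] using col_B by auto
    then show ?thesis unfolding M centered_mat_kernel[OF B u] by simp
  qed
  then show ?thesis
    using rank_full_iff[OF Mc] unfolding d_def V_def M_def by auto
qed

section \<open>Zero error for two views\<close>

text \<open>A point seen by one view only can be placed wherever that view puts it. At a common
  point the two equations share \<open>z k\<close>; eliminating it leaves the difference of the two
  translations.\<close>

lemma alignment_error_two_views:
  assumes wf: "wf_patch_framework \<Theta>"
    and conn: "Digraph_Component.connected (with_proj (patch_graph \<Theta>))"
    and m: "nviews \<Theta> = 2"
    and Ss: "\<And>i. i < 2 \<Longrightarrow> Ss i \<in> carrier_mat (amb_dim \<Theta>) (amb_dim \<Theta>)"
  shows "alignment_error \<Theta> (stack 2 (amb_dim \<Theta>) Ss) = 0 \<longleftrightarrow>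
    (\<exists>t\<in>carrier_vec (amb_dim \<Theta>). \<forall>k\<in>view_points \<Theta> 0 \<inter> view_points \<Theta> 1.
      (Ss 0)\<^sup>T *\<^sub>v coord \<Theta> k 0 = (Ss 1)\<^sup>T *\<^sub>v coord \<Theta> k 1 + t)" (is "?l \<longleftrightarrow> ?r")
proof -
  define d where "d = amb_dim \<Theta>"
  define f where "f = (\<lambda>k i. (Ss i)\<^sup>T *\<^sub>v coord \<Theta> k i)"
  have f: "f k i \<in> carrier_vec d" if "i < 2" for k i
    using Ss[OF that] unfolding f_def d_def
    by (metis carrier_matD(2) carrier_vec_dim_vec dim_mult_mat_vec index_transpose_mat(2))
  have "?l \<longleftrightarrow> (\<exists>z t. (\<forall>k. z k \<in> carrier_vec d) \<and> (\<forall>i. t i \<in> carrier_vec d) \<and>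
        (\<forall>(k, i)\<in>edges \<Theta>. f k i = z k - t i))" (is "_ \<longleftrightarrow> ?m")
    unfolding d_def f_def
    by (rule alignment_error_stack(2)[OF wf conn, unfolded m, OF Ss])
  also have "\<dots> \<longleftrightarrow> (\<exists>t\<in>carrier_vec d. \<forall>k\<in>view_points \<Theta> 0 \<inter> view_points \<Theta> 1. f k 0 = f k 1 + t)"
    (is "_ \<longleftrightarrow> ?r'")
  proof
    assume ?m
    then obtain z t where z: "\<And>k. z k \<in> carrier_vec d" and t: "\<And>i. t i \<in> carrier_vec d"
      and eq: "\<And>k i. (k, i) \<in> edges \<Theta> \<Longrightarrow> f k i = z k - t i" by blast
    have "f k 0 = f k 1 + (t 1 - t 0)" if "k \<in> view_points \<Theta> 0 \<inter> view_points \<Theta> 1" for k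
    proof -
      have "f k 0 = z k - t 0" "f k 1 = z k - t 1" using that eq by (auto simp: view_points_def)
      moreover have "z k - t 0 = (z k - t 1) + (t 1 - t 0)"
        by (rule eq_vecI) (use z[of k] t[of 0] t[of 1] in auto)
      ultimately show ?thesis by simp
    qed
    then show ?r' using t by (intro bexI[of _ "t 1 - t 0"]) auto
  next
    assume ?r'
    then obtain t where t: "t \<in> carrier_vec d"
      and eq: "\<And>k. (k, 0) \<in> edges \<Theta> \<Longrightarrow> (k, 1) \<in> edges \<Theta> \<Longrightarrow> f k 0 = f k 1 + t"
      by (auto simp: view_points_def)
    \<comment> \<open>View 0 stays in place and view 1 carries the whole translation. At common
      points both views give the same \<open>z k\<close> by \<open>eq\<close>.\<close>
    define z where "z = (\<lambda>k. if (k, 0) \<in> edges \<Theta> then f k 0 else f k 1 + t)"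
    define t' where "t' = (\<lambda>i :: nat. if i = 0 then 0\<^sub>v d else t)"
    have "f k i = z k - t' i" if e: "(k, i) \<in> edges \<Theta>" for k i
    proof (cases "i = 0")
      case True
      then show ?thesis using e f[of 0 k] by (simp add: z_def t'_def)
    next
      case False
      then have i: "i = 1" using wf_edge(2)[OF wf e] m by simp
      then have "z k = f k 1 + t" using e eq by (simp add: z_def)
      moreover have "f k 1 = f k 1 + t - t"
        by (rule eq_vecI) (use f[of 1 k] t in auto)
      ultimately show ?thesis using i by (simp add: t'_def)
    qed
    moreover have "z k \<in> carrier_vec d" for k using f t by (simp add: z_def)
    moreover have "t' i \<in> carrier_vec d" for i using t by (simp add: t'_def)
    ultimately show ?m by (intro exI[of _ z] exI[of _ t']) auto
  qed
  finally show ?thesis by (simp add: f_def d_def)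
qed

section \<open>Stacked matrices, the orthogonal group and reflections\<close>

lemma stack_mult:
  assumes "\<And>i. i < m \<Longrightarrow> Ss i \<in> carrier_mat d d" "Q \<in> carrier_mat d d"
  shows "stack m d Ss * Q = stack m d (\<lambda>i. Ss i * Q)"
proof (rule eq_matI)
  fix a b assume "a < dim_row (stack m d (\<lambda>i. Ss i * Q))" "b < dim_col (stack m d (\<lambda>i. Ss i * Q))"
  then have a: "a < m * d" and b: "b < d" by (auto simp: stack_def)
  have ad: "a div d < m" "a mod d < d" using a b by (auto simp: less_mult_imp_div_less)
  show "(stack m d Ss * Q) $$ (a, b) = stack m d (\<lambda>i. Ss i * Q) $$ (a, b)"
    using a b ad assms(1)[OF ad(1)] assms(2) by (simp add: stack_def scalar_prod_def)
qed (use assms in \<open>auto simp: stack_def\<close>)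

lemma stack_eqD:
  assumes eq: "stack m d Ss = stack m d Ts" and i: "i < m"
    and "Ss i \<in> carrier_mat d d" "Ts i \<in> carrier_mat d d"
  shows "Ss i = Ts i"
proof (rule eq_matI)
  fix a b assume "a < dim_row (Ts i)" "b < dim_col (Ts i)"
  then have a: "a < d" and b: "b < d" using assms(4) by auto
  have "i * d + a < m * d"
    using mult_le_mono1[of "Suc i" m d] i a by simp
  then show "Ss i $$ (a, b) = Ts i $$ (a, b)"
    using arg_cong[OF eq, of "\<lambda>A. A $$ (i * d + a, b)"] a b by (simp add: stack_def)
qed (use assms in auto)

lemma orthogonal_group_mult:
  assumes "P \<in> orthogonal_group d" "Q \<in> orthogonal_group d"
  shows "P * Q \<in> orthogonal_group d"
proof -
  have P: "P \<in> carrier_mat d d" "P\<^sup>T \<in> carrier_mat d d" "P\<^sup>T * P = 1\<^sub>m d" "P * P\<^sup>T = 1\<^sub>m d"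
    and Q: "Q \<in> carrier_mat d d" "Q\<^sup>T \<in> carrier_mat d d" "Q\<^sup>T * Q = 1\<^sub>m d" "Q * Q\<^sup>T = 1\<^sub>m d"
    using assms by (auto simp: orthogonal_group_def)
  have "Q\<^sup>T * P\<^sup>T * (P * Q) = Q\<^sup>T * (P\<^sup>T * P * Q)"
    using assoc_mult_mat[of "Q\<^sup>T" d d "P\<^sup>T" d "P * Q" d] assoc_mult_mat[OF P(2,1) Q(1)] P(1,2) Q(1,2)
    by simp
  also have "\<dots> = 1\<^sub>m d" unfolding P(3) using Q by simp
  finally have 1: "Q\<^sup>T * P\<^sup>T * (P * Q) = 1\<^sub>m d" .
  have "P * Q * (Q\<^sup>T * P\<^sup>T) = P * (Q * Q\<^sup>T * P\<^sup>T)"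
    using assoc_mult_mat[of P d d Q d "Q\<^sup>T * P\<^sup>T" d] assoc_mult_mat[OF Q(1,2) P(2)] P(1,2) Q(1,2)
    by simp
  also have "\<dots> = 1\<^sub>m d" unfolding Q(4) using P by simp
  finally have 2: "P * Q * (Q\<^sup>T * P\<^sup>T) = 1\<^sub>m d" .
  show ?thesis
    using P Q 1 2 by (simp add: orthogonal_group_def transpose_mult[OF P(1) Q(1)])
qed

lemma orthogonal_group_transpose: "P \<in> orthogonal_group d \<Longrightarrow> P\<^sup>T \<in> orthogonal_group d"
  by (simp add: orthogonal_group_def)

text \<open>The Householder matrix of \<open>u\<close>, the identity minus
  \<open>2 / (u \<bullet> u)\<close> times the outer product of \<open>u\<close> with itself. It
  negates \<open>u\<close> and is symmetric, so its columns satisfy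
  \<open>u \<bullet> col H b = - u $ b\<close>; applying \<open>H\<close> to a column then restores
  the identity, and a symmetric matrix of square 1 is orthogonal.\<close>

lemma obtain_reflection:
  fixes u :: "real vec"
  assumes u: "u \<in> carrier_vec d" and "u \<noteq> 0\<^sub>v d"
  obtains H where "H \<in> orthogonal_group d" "H\<^sup>T = H"
    "\<And>x. x \<in> carrier_vec d \<Longrightarrow> H *\<^sub>v x = x - (2 * (u \<bullet> x) / (u \<bullet> u)) \<cdot>\<^sub>v u"
proof -
  have uu: "u \<bullet> u \<noteq> 0" using assms scalar_prod_eq_0_real by blast
  define H where "H = mat d d (\<lambda>(a, b). (if a = b then 1 else 0) - 2 * u $ a * u $ b / (u \<bullet> u))"
  have H: "H \<in> carrier_mat d d" by (simp add: H_def)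
  have HT: "H\<^sup>T = H" by (rule eq_matI) (auto simp: H_def)
  have Hx: "H *\<^sub>v x = x - (2 * (u \<bullet> x) / (u \<bullet> u)) \<cdot>\<^sub>v u" if x: "x \<in> carrier_vec d" for x
  proof (rule eq_vecI)
    fix a assume "a < dim_vec (x - (2 * (u \<bullet> x) / (u \<bullet> u)) \<cdot>\<^sub>v u)"
    then have a: "a < d" using u by simp
    define r where "r = 2 * u $ a / (u \<bullet> u)"
    have "(H *\<^sub>v x) $ a = (\<Sum>b\<in>{0..<d}. (if a = b then x $ b else 0) - r * (u $ b * x $ b))"
      using a x by (auto simp: H_def r_def scalar_prod_def[of _ x] algebra_simps intro!: sum.cong)
    also have "\<dots> = x $ a - r * (u \<bullet> x)"
      using a x by (simp add: sum_subtractf sum_distrib_left[symmetric] scalar_prod_def)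
    finally show "(H *\<^sub>v x) $ a = (x - (2 * (u \<bullet> x) / (u \<bullet> u)) \<cdot>\<^sub>v u) $ a"
      using a x u by (simp add: r_def algebra_simps)
  qed (use H u x in simp)
  have Hu: "H *\<^sub>v u = - u"
    using u uu by (intro eq_vecI) (auto simp: Hx)
  have "H * H = 1\<^sub>m d"
  proof (rule eq_matI)
    fix a b assume "a < dim_row (1\<^sub>m d :: real mat)" "b < dim_col (1\<^sub>m d :: real mat)"
    then have a: "a < d" and b: "b < d" by auto
    have c: "col H b \<in> carrier_vec d" using H b by (metis carrier_matD(1) col_dim)
    have "row H b = col H b" using HT b H by (metis carrier_matD(1) col_transpose)
    then have "u \<bullet> col H b = (H *\<^sub>v u) $ b"
      using H b comm_scalar_prod[OF u c] by simp
    then have ub: "u \<bullet> col H b = - u $ b" using Hu b u by simp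
    have "(H * H) $$ (a, b) = (H *\<^sub>v col H b) $ a" using a b H by simp
    also have "\<dots> = H $$ (a, b) + 2 * u $ b / (u \<bullet> u) * u $ a"
      using a b H u by (subst Hx[OF c]) (simp add: ub)
    also have "\<dots> = 1\<^sub>m d $$ (a, b)" using a b by (simp add: H_def)
    finally show "(H * H) $$ (a, b) = 1\<^sub>m d $$ (a, b)" .
  qed (use H in auto)
  then have "H \<in> orthogonal_group d" using H HT by (simp add: orthogonal_group_def)
  then show ?thesis using that HT Hx by blast
qed

section \<open>Uniqueness of a perfect alignment of two views\<close>

theorem theorem4p7:
  fixes \<Theta> :: patch_framework and S :: "real mat"
  assumes "wf_patch_framework \<Theta>"
    and "Digraph_Component.connected (with_proj (patch_graph \<Theta>))"
    and "\<forall>i<nviews \<Theta>. affinely_nondegenerate \<Theta> i"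
    and "nviews \<Theta> = 2"
    and "perfect_alignment \<Theta> S"
  shows "unique_alignment \<Theta> S \<longleftrightarrow>
    vec_space.rank (amb_dim \<Theta>) (centered_overlap_mat \<Theta> 0 1) = amb_dim \<Theta>"
proof -
  note wf = assms(1) and conn = assms(2) and m = assms(4)
  define d where "d = amb_dim \<Theta>"
  define V where "V = view_points \<Theta> 0 \<inter> view_points \<Theta> 1"
  let ?x = "\<lambda>k. coord \<Theta> k 0" and ?y = "\<lambda>k. coord \<Theta> k 1"
  have x: "?x k \<in> carrier_vec d" and y: "?y k \<in> carrier_vec d" if "k \<in> V" for k
    using that wf_edge(3)[OF wf] by (auto simp: V_def view_points_def d_def)
  have orth_carrier: "A \<in> carrier_mat d d" if "A \<in> orthogonal_group d" for A
    using that by (simp add: orthogonal_group_def)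
  have al: "A \<in> alignments \<Theta> \<longleftrightarrow> (\<exists>As. A = stack 2 d As \<and> (\<forall>i<2. As i \<in> orthogonal_group d))" for A
    unfolding alignments_def m d_def by blast
  have err_nonneg: "alignment_error \<Theta> A \<ge> 0" if "A \<in> alignments \<Theta>" for A
    using that alignment_error_stack(1)[OF wf conn] orth_carrier unfolding al m d_def by blast
  \<comment> \<open>The error is nonnegative and \<open>S\<close> attains 0, so the optimal
    alignments are exactly those of error 0.\<close>
  have opt: "optimal_alignment \<Theta> A \<longleftrightarrow> A \<in> alignments \<Theta> \<and> alignment_error \<Theta> A = 0" for A
    using err_nonneg assms(5) unfolding optimal_alignment_def perfect_alignment_def by (metis order_antisym)
  have err: "alignment_error \<Theta> (stack 2 d As) = 0 \<longleftrightarrow>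
      (\<exists>t\<in>carrier_vec d. \<forall>k\<in>V. (As 0)\<^sup>T *\<^sub>v ?x k = (As 1)\<^sup>T *\<^sub>v ?y k + t)"
    if "\<forall>i<2. As i \<in> orthogonal_group d" for As
    unfolding d_def V_def using that orth_carrier
    by (intro alignment_error_two_views[OF wf conn m]) (simp add: d_def)
  obtain Ss where S: "S = stack 2 d Ss" and Ss: "\<forall>i<2. Ss i \<in> orthogonal_group d"
    using assms(5) unfolding perfect_alignment_def al by blast
  define S0 S1 where "S0 = Ss 0" and "S1 = Ss 1"
  have S0: "S0 \<in> orthogonal_group d" and S1: "S1 \<in> orthogonal_group d"
    using Ss by (auto simp: S0_def S1_def)
  obtain t where t: "t \<in> carrier_vec d" and St: "\<And>k. k \<in> V \<Longrightarrow> S0\<^sup>T *\<^sub>v ?x k = S1\<^sup>T *\<^sub>v ?y k + t"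
    using assms(5) err[OF Ss] unfolding perfect_alignment_def S S0_def S1_def by blast
  have optS: "optimal_alignment \<Theta> S" using assms(5) opt unfolding perfect_alignment_def by blast
  have rank: "vec_space.rank (amb_dim \<Theta>) (centered_overlap_mat \<Theta> 0 1) = amb_dim \<Theta> \<longleftrightarrow>
      (\<forall>u\<in>carrier_vec d. (\<exists>c. \<forall>k\<in>V. u \<bullet> ?x k = c) \<longrightarrow> u = 0\<^sub>v d)"
    unfolding d_def V_def by (rule rank_centered_overlap_mat_iff[OF wf])
  show ?thesis unfolding rank
  proof (intro iffI ballI impI)
    fix u :: "real vec"
    assume uniq: "unique_alignment \<Theta> S" and u: "u \<in> carrier_vec d" and "\<exists>c. \<forall>k\<in>V. u \<bullet> ?x k = c"
    then obtain c where c: "\<And>k. k \<in> V \<Longrightarrow> u \<bullet> ?x k = c" by blast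
    show "u = 0\<^sub>v d"
    proof (rule ccontr)
      assume u0: "u \<noteq> 0\<^sub>v d"
      then obtain H where H: "H \<in> orthogonal_group d" and HT: "H\<^sup>T = H"
        and Hx: "\<And>x. x \<in> carrier_vec d \<Longrightarrow> H *\<^sub>v x = x - (2 * (u \<bullet> x) / (u \<bullet> u)) \<cdot>\<^sub>v u"
        using obtain_reflection[OF u] by blast
      \<comment> \<open>The second perfect alignment: view 0 is reflected along \<open>u\<close>
        before \<open>S0\<close> acts, view 1 is kept.\<close>
      define As where "As = (\<lambda>i :: nat. if i = 0 then H * S0 else S1)"
      have As: "\<forall>i<2. As i \<in> orthogonal_group d"
        using orthogonal_group_mult[OF H S0] S1 by (simp add: As_def)
      \<comment> \<open>On common points \<open>u \<bullet> ?x k = c\<close>, so there the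
        reflection is the translation by \<open>- g \<cdot>\<^sub>v u\<close>, which the translation
        term absorbs.\<close>
      define g where "g = 2 * c / (u \<bullet> u)"
      have "(H * S0)\<^sup>T *\<^sub>v ?x k = S1\<^sup>T *\<^sub>v ?y k + (t - S0\<^sup>T *\<^sub>v (g \<cdot>\<^sub>v u))" if k: "k \<in> V" for k
      proof -
        have S0T: "S0\<^sup>T \<in> carrier_mat d d" and S1T: "S1\<^sup>T \<in> carrier_mat d d"
          using orth_carrier[OF S0] orth_carrier[OF S1] by auto
        have gu: "g \<cdot>\<^sub>v u \<in> carrier_vec d" using u by simp
        have "(H * S0)\<^sup>T *\<^sub>v ?x k = (S0\<^sup>T * H) *\<^sub>v ?x k"
          using transpose_mult[OF orth_carrier[OF H] orth_carrier[OF S0]] HT by simp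
        also have "\<dots> = S0\<^sup>T *\<^sub>v (?x k - g \<cdot>\<^sub>v u)"
          using assoc_mult_mat_vec[OF S0T orth_carrier[OF H] x[OF k]] Hx[OF x[OF k]] c[OF k]
          by (simp add: g_def)
        also have "\<dots> = S0\<^sup>T *\<^sub>v ?x k - S0\<^sup>T *\<^sub>v (g \<cdot>\<^sub>v u)"
          by (rule mult_minus_distrib_mat_vec[OF S0T x[OF k] gu])
        also have "\<dots> = S1\<^sup>T *\<^sub>v ?y k + (t - S0\<^sup>T *\<^sub>v (g \<cdot>\<^sub>v u))"
          unfolding St[OF k]
          by (rule eq_vecI) (use S0T S1T t in \<open>auto simp del: index_mult_mat_vec\<close>)
        finally show ?thesis .
      qed
      moreover have "t - S0\<^sup>T *\<^sub>v (g \<cdot>\<^sub>v u) \<in> carrier_vec d"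
        using t mult_mat_vec_carrier[of "S0\<^sup>T" d d "g \<cdot>\<^sub>v u"] orth_carrier[OF S0] u by simp
      ultimately have "alignment_error \<Theta> (stack 2 d As) = 0"
        unfolding err[OF As] by (auto simp: As_def)
      then have optA: "optimal_alignment \<Theta> (stack 2 d As)" unfolding opt al using As by blast
      \<comment> \<open>\<open>unique_alignment\<close> speaks of alignments other than
        \<open>S\<close>; if the two coincide, \<open>Q\<close> is the identity.\<close>
      have "\<exists>Q\<in>orthogonal_group d. stack 2 d As = S * Q"
      proof (cases "stack 2 d As = S")
        case True
        have "S = S * 1\<^sub>m d" using S right_mult_one_mat[OF stack_carrier] by simp
        moreover have "1\<^sub>m d \<in> orthogonal_group d" by (simp add: orthogonal_group_def)
        ultimately show ?thesis using True by metis
      next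
        case False
        then show ?thesis using uniq optA unfolding unique_alignment_def d_def by blast
      qed
      then obtain Q where Q: "Q \<in> orthogonal_group d" and "stack 2 d As = S * Q" by blast
      then have eq: "stack 2 d As = stack 2 d (\<lambda>i. Ss i * Q)"
        using stack_mult[of 2 Ss d Q] Ss orth_carrier S by simp
      have SQ: "As i = Ss i * Q" if "i < 2" for i
        using stack_eqD[OF eq that] that As Ss Q orth_carrier orthogonal_group_mult by metis
      have Qc: "Q \<in> carrier_mat d d" by (rule orth_carrier[OF Q])
      \<comment> \<open>The unchanged block of view 1 forces \<open>Q = 1\<^sub>m d\<close>; the
        block of view 0 then forces \<open>H = 1\<^sub>m d\<close>, although \<open>H\<close>
        negates \<open>u\<close>.\<close>
      have "S1\<^sup>T * S1 * Q = S1\<^sup>T * S1"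
        using SQ[of 1] orth_carrier[OF S1] Qc by (simp add: As_def S1_def)
      then have "Q = 1\<^sub>m d" using S1 Qc by (simp add: orthogonal_group_def)
      then have "H * S0 = S0" using SQ[of 0] orth_carrier[OF S0] by (simp add: As_def S0_def)
      then have "H * (S0 * S0\<^sup>T) = S0 * S0\<^sup>T"
        using assoc_mult_mat[OF orth_carrier[OF H] orth_carrier[OF S0], of "S0\<^sup>T" d] orth_carrier[OF S0]
        by simp
      then have "H = 1\<^sub>m d" using S0 orth_carrier[OF H] by (simp add: orthogonal_group_def)
      then have "H *\<^sub>v u = u" using u by simp
      moreover have "u \<bullet> u \<noteq> 0" using u0 scalar_prod_eq_0_real[OF u] by blast
      then have "H *\<^sub>v u = u - 2 \<cdot>\<^sub>v u" using Hx[OF u] by simp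
      ultimately have eq_u: "u = u - 2 \<cdot>\<^sub>v u" by (rule trans[OF sym])
      have "u = 0\<^sub>v d"
      proof (rule eq_vecI)
        fix a assume "a < dim_vec (0\<^sub>v d :: real vec)"
        then show "u $ a = 0\<^sub>v d $ a" using arg_cong[OF eq_u, of "\<lambda>v. v $ a"] u by simp
      qed (use u in simp)
      with u0 show False ..
    qed
  next
    assume r: "\<forall>u\<in>carrier_vec d. (\<exists>c. \<forall>k\<in>V. u \<bullet> ?x k = c) \<longrightarrow> u = 0\<^sub>v d"
    have "\<exists>Q\<in>orthogonal_group d. O' = S * Q" if O': "optimal_alignment \<Theta> O'" for O'
    proof -
      obtain Os where OO: "O' = stack 2 d Os" and Os: "\<forall>i<2. Os i \<in> orthogonal_group d"
        using O' unfolding opt al by blast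
      define O0 O1 where "O0 = Os 0" and "O1 = Os 1"
      have O0: "O0 \<in> orthogonal_group d" and O1: "O1 \<in> orthogonal_group d"
        using Os by (auto simp: O0_def O1_def)
      obtain t' where t': "t' \<in> carrier_vec d"
        and Ot: "\<And>k. k \<in> V \<Longrightarrow> O0\<^sup>T *\<^sub>v ?x k = O1\<^sup>T *\<^sub>v ?y k + t'"
        using O' err[OF Os] unfolding opt OO O0_def O1_def by blast
      \<comment> \<open>Solving for the coordinates in view 1 yields a rigid motion with linear part
        \<open>B * A\<^sup>T\<close>. Its images of the common points agree for \<open>S\<close> and
        \<open>O'\<close> up to a translation.\<close>
      have move: "(B * A\<^sup>T) *\<^sub>v ?x k = ?y k + B *\<^sub>v \<tau>"
        if "A \<in> orthogonal_group d" "B \<in> orthogonal_group d" "\<tau> \<in> carrier_vec d" "k \<in> V"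
          and "A\<^sup>T *\<^sub>v ?x k = B\<^sup>T *\<^sub>v ?y k + \<tau>" for A B \<tau> k
      proof -
        have A: "A\<^sup>T \<in> carrier_mat d d" and B: "B \<in> carrier_mat d d" "B\<^sup>T \<in> carrier_mat d d"
          using that orth_carrier by auto
        have By: "B\<^sup>T *\<^sub>v ?y k \<in> carrier_vec d" using B y[OF that(4)] by simp
        have "(B * A\<^sup>T) *\<^sub>v ?x k = B *\<^sub>v (B\<^sup>T *\<^sub>v ?y k + \<tau>)"
          unfolding that(5)[symmetric] by (rule assoc_mult_mat_vec[OF B(1) A x[OF that(4)]])
        also have "\<dots> = (B * B\<^sup>T) *\<^sub>v ?y k + B *\<^sub>v \<tau>"
          unfolding mult_add_distrib_mat_vec[OF B(1) By that(3)] assoc_mult_mat_vec[OF B y[OF that(4)]] ..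
        finally show ?thesis using that(2) y[OF that(4)] by (simp add: orthogonal_group_def)
      qed
      have R: "S1 * S0\<^sup>T \<in> carrier_mat d d" "O1 * O0\<^sup>T \<in> carrier_mat d d"
        using orth_carrier S0 S1 O0 O1 orthogonal_group_mult orthogonal_group_transpose by blast+
      have R_eq: "S1 * S0\<^sup>T = O1 * O0\<^sup>T"
      proof (rule eq_rowI)
        fix a assume "a < dim_row (O1 * O0\<^sup>T)"
        then have a: "a < d" unfolding carrier_matD(1)[OF R(2)] .
        define p q where "p = row (S1 * S0\<^sup>T) a" and "q = row (O1 * O0\<^sup>T) a"
        \<comment> \<open>The difference of corresponding rows of the two linear parts has a
          constant product with the common points, given by the translations, so the rank condition
          makes it 0.\<close>
        define u where "u = p - q"
        have rows: "p \<in> carrier_vec d" "q \<in> carrier_vec d"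
          using R a unfolding p_def q_def by (metis row_carrier_vec)+
        have u: "u \<in> carrier_vec d" using rows by (simp add: u_def)
        have "u \<bullet> ?x k = (S1 *\<^sub>v t) $ a - (O1 *\<^sub>v t') $ a" if k: "k \<in> V" for k
        proof -
          have "u \<bullet> ?x k = ((S1 * S0\<^sup>T) *\<^sub>v ?x k) $ a - ((O1 * O0\<^sup>T) *\<^sub>v ?x k) $ a"
            unfolding u_def minus_scalar_prod_distrib[OF rows x[OF k]]
            unfolding p_def q_def
            using index_mult_mat_vec[OF a[folded carrier_matD(1)[OF R(1)]]]
              index_mult_mat_vec[OF a[folded carrier_matD(1)[OF R(2)]]] by metis
          then show ?thesis
            using a y[OF k] orth_carrier[OF S1] orth_carrier[OF O1] t t'
            unfolding move[OF S0 S1 t k St[OF k]] move[OF O0 O1 t' k Ot[OF k]]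
            by (simp del: index_mult_mat_vec)
        qed
        then have u0: "u = 0\<^sub>v d" using r u by blast
        have "p = q"
        proof (rule eq_vecI)
          fix b assume "b < dim_vec q"
          then show "p $ b = q $ b"
            using arg_cong[OF u0, of "\<lambda>v. v $ b"] rows unfolding u_def by simp
        qed (use rows in simp)
        then show "row (S1 * S0\<^sup>T) a = row (O1 * O0\<^sup>T) a" by (simp only: p_def q_def)
      qed (use R in \<open>simp_all only: carrier_matD\<close>)
      \<comment> \<open>The only choice that the block of view 0 allows; \<open>R_eq\<close> makes
        it work for view 1.\<close>
      define Q where "Q = S0\<^sup>T * O0"
      have Q: "Q \<in> orthogonal_group d"
        unfolding Q_def by (intro orthogonal_group_mult orthogonal_group_transpose S0 O0)
      have cs: "S0 \<in> carrier_mat d d" "S1 \<in> carrier_mat d d" "O0 \<in> carrier_mat d d" "O1 \<in> carrier_mat d d"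
        "S0\<^sup>T \<in> carrier_mat d d" "O0\<^sup>T \<in> carrier_mat d d"
        using orth_carrier S0 S1 O0 O1 by auto
      have "S0 * Q = S0 * S0\<^sup>T * O0"
        unfolding Q_def by (rule assoc_mult_mat[OF cs(1,5,3), symmetric])
      also have "S0 * S0\<^sup>T = 1\<^sub>m d" using S0 unfolding orthogonal_group_def by blast
      finally have Q0: "S0 * Q = O0" using cs by simp
      have "S1 * Q = O1 * O0\<^sup>T * O0"
        unfolding Q_def R_eq[symmetric] by (rule assoc_mult_mat[OF cs(2,5,3), symmetric])
      also have "\<dots> = O1 * (O0\<^sup>T * O0)" by (rule assoc_mult_mat[OF cs(4,6,3)])
      finally have Q1: "S1 * Q = O1" using O0 cs by (simp add: orthogonal_group_def)
      have "Ss i * Q = Os i" if "i < 2" for i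
        using that Q0 Q1 by (cases "i = 0") (auto simp: S0_def S1_def O0_def O1_def less_2_cases_iff)
      then have "stack 2 d (\<lambda>i. Ss i * Q) = stack 2 d Os"
        unfolding stack_def by (intro eq_matI) (auto simp: less_mult_imp_div_less)
      then have "O' = S * Q"
        using stack_mult[of 2 Ss d Q] Ss orth_carrier Q OO S by simp
      then show ?thesis using Q by blast
    qed
    then show "unique_alignment \<Theta> S" using optS unfolding unique_alignment_def d_def by blast
  qed
qed

end
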